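(* If $\mathbb X$ is a non-constant relational structure which is chained by a linear order isomorphic to a suborder of the real line containing a perfect set, then $\mathbb B_{\mathbb X}\cong\mathrm{ro}(\mathbb S)\cong\mathrm{ro}(\mathrm{Borel}(\mathbb R)/[\mathbb R]^{\le\omega})$.
   Context: For a relational structure $\mathbb X$ with domain $X$: $\mathbb P(\mathbb X)=\{f[X]:f$ a self-embedding of $\mathbb X\}$ ordered by $\subset$, and $\mathbb B_{\mathbb X}=\mathrm{ro}(\mathrm{sq}(\mathbb P(\mathbb X)))$ is the Boolean completion of its separative quotient. $\mathbb X$ is chained by a linear order $\langle X,\lhd\rangle$ iff every partial automorphism (isomorphism between finite or arbitrary substructures) of $\langle X,\lhd\rangle$ is a partial automorphism of $\mathbb X$. $\mathbb X$ is constant iff every bijection of $X$ is an automorphism. $\mathbb S$ is the Sacks forcing (perfect subsets of $\mathbb R$ ordered by inclusion); $\mathrm{Borel}(\mathbb R)/[\mathbb R]^{\le\omega}$ is the algebra of Borel sets modulo countable sets. *)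

theory Defs
  imports "HOL-Analysis.Analysis"
begin

section \<open>Relational structures\<close>

text \<open>The language is the index type \<open>'i\<close> together with the arities; a relation of arity \<open>n\<close> is a
  set of lists of length \<open>n\<close>.\<close>

record ('i, 'x) rel_struct =
  univ :: "'x set"
  arity :: "'i \<Rightarrow> nat"
  interp :: "'i \<Rightarrow> 'x list set"

definition rel_structure :: "('i, 'x) rel_struct \<Rightarrow> bool" where
  "rel_structure X \<longleftrightarrow>
     univ X \<noteq> {} \<and> (\<forall>i. interp X i \<subseteq> {xs. length xs = arity X i \<and> set xs \<subseteq> univ X})"

definition substructure :: "('i, 'x) rel_struct \<Rightarrow> 'x set \<Rightarrow> ('i, 'x) rel_struct" where
  "substructure X A =
     \<lparr>univ = A, arity = arity X, interp = (\<lambda>i. {xs \<in> interp X i. set xs \<subseteq> A})\<rparr>"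

definition embedding ::
    "('i, 'x) rel_struct \<Rightarrow> ('i, 'y) rel_struct \<Rightarrow> ('x \<Rightarrow> 'y) \<Rightarrow> bool" where
  "embedding X Y f \<longleftrightarrow>
     arity X = arity Y \<and> inj_on f (univ X) \<and> f ` univ X \<subseteq> univ Y \<and>
     (\<forall>i xs. length xs = arity X i \<longrightarrow> set xs \<subseteq> univ X \<longrightarrow>
        (xs \<in> interp X i \<longleftrightarrow> map f xs \<in> interp Y i))"

definition isomorphism ::
    "('i, 'x) rel_struct \<Rightarrow> ('i, 'y) rel_struct \<Rightarrow> ('x \<Rightarrow> 'y) \<Rightarrow> bool" where
  "isomorphism X Y f \<longleftrightarrow> embedding X Y f \<and> f ` univ X = univ Y"

definition isomorphic :: "('i, 'x) rel_struct \<Rightarrow> ('i, 'y) rel_struct \<Rightarrow> bool" where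
  "isomorphic X Y \<longleftrightarrow> (\<exists>f. isomorphism X Y f)"

text \<open>A partial map with domain \<open>A\<close> and range \<open>B\<close> is represented by a total function of which only
  the restriction to \<open>A\<close> matters.\<close>

definition partial_automorphism ::
    "('i, 'x) rel_struct \<Rightarrow> 'x set \<Rightarrow> 'x set \<Rightarrow> ('x \<Rightarrow> 'x) \<Rightarrow> bool" where
  "partial_automorphism X A B f \<longleftrightarrow>
     A \<subseteq> univ X \<and> B \<subseteq> univ X \<and> isomorphism (substructure X A) (substructure X B) f"

definition constant_structure :: "('i, 'x) rel_struct \<Rightarrow> bool" where
  "constant_structure X \<longleftrightarrow> (\<forall>f. bij_betw f (univ X) (univ X) \<longrightarrow> isomorphism X X f)"

definition order_structure :: "'x set \<Rightarrow> 'x rel \<Rightarrow> (unit, 'x) rel_struct" where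
  "order_structure A r = \<lparr>univ = A, arity = (\<lambda>_. 2), interp = (\<lambda>_. {[x, y] | x y. (x, y) \<in> r})\<rparr>"

definition real_line :: "(unit, real) rel_struct" where
  "real_line = order_structure UNIV (relation_of (<) UNIV)"

definition chained_by :: "('i, 'x) rel_struct \<Rightarrow> 'x rel \<Rightarrow> bool" where
  "chained_by X r \<longleftrightarrow>
     (\<forall>A B f. partial_automorphism (order_structure (univ X) r) A B f \<longrightarrow>
        partial_automorphism X A B f)"

text \<open>Since all arities are finite, it makes no difference whether partial automorphisms are taken
  between arbitrary or only between finite substructures.\<close>

lemma chained_by_iff_finite:
  "chained_by X r \<longleftrightarrow>
     (\<forall>A B f. finite A \<longrightarrow> partial_automorphism (order_structure (univ X) r) A B f \<longrightarrow>
        partial_automorphism X A B f)" (is "_ \<longleftrightarrow> ?fin")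
proof
  assume fin: ?fin
  show "chained_by X r"
    unfolding chained_by_def
  proof (intro allI impI)
    fix A B f
    assume pa: "partial_automorphism (order_structure (univ X) r) A B f"
    then have AB: "A \<subseteq> univ X" "B \<subseteq> univ X" "inj_on f A" "f ` A = B"
      by (auto simp: partial_automorphism_def isomorphism_def embedding_def
          substructure_def order_structure_def)
    have "xs \<in> interp X i \<longleftrightarrow> map f xs \<in> interp X i"
      if xs: "length xs = arity X i" "set xs \<subseteq> A" for i xs
    proof -
      have inj: "inj_on f (set xs)"
        using AB(3) xs(2) by (rule inj_on_subset)
      have "partial_automorphism (order_structure (univ X) r) (set xs) (f ` set xs) f"
        unfolding partial_automorphism_def isomorphism_def embedding_def
      proof (intro conjI allI impI)
        fix j ys
        assume ys: "length ys = arity (substructure (order_structure (univ X) r) (set xs)) j"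
          "set ys \<subseteq> univ (substructure (order_structure (univ X) r) (set xs))"
        with pa xs(2) have "ys \<in> interp (substructure (order_structure (univ X) r) A) j \<longleftrightarrow>
            map f ys \<in> interp (substructure (order_structure (univ X) r) B) j"
          unfolding partial_automorphism_def isomorphism_def embedding_def
          by (auto simp: substructure_def)
        then show "ys \<in> interp (substructure (order_structure (univ X) r) (set xs)) j \<longleftrightarrow>
            map f ys \<in> interp (substructure (order_structure (univ X) r) (f ` set xs)) j"
          using ys xs(2) AB(4) by (auto simp: substructure_def)
      qed (use AB xs inj in \<open>auto simp: substructure_def order_structure_def\<close>)
      with fin have "partial_automorphism X (set xs) (f ` set xs) f"
        by blast
      then show ?thesis
        using xs by (auto simp: partial_automorphism_def isomorphism_def embedding_def substructure_def)
    qed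
    with AB show "partial_automorphism X A B f"
      by (auto simp: partial_automorphism_def isomorphism_def embedding_def substructure_def)
  qed
qed (simp add: chained_by_def)

definition copies :: "('i, 'x) rel_struct \<Rightarrow> 'x set set" where
  "copies X = {f ` univ X | f. embedding X X f}"

definition copies_poset :: "('i, 'x) rel_struct \<Rightarrow> 'x set rel" where
  "copies_poset X = relation_of (\<subseteq>) (copies X)"


section \<open>Separative quotient and regular open algebra\<close>

text \<open>A preorder is given by its order relation, a set of pairs \<open>(p, q)\<close> with \<open>p \<le> q\<close>; by
  reflexivity its carrier is the field of the relation.\<close>

definition compatible :: "'a rel \<Rightarrow> 'a \<Rightarrow> 'a \<Rightarrow> bool" where
  "compatible r p q \<longleftrightarrow> (\<exists>s. (s, p) \<in> r \<and> (s, q) \<in> r)"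

definition sep_modification :: "'a rel \<Rightarrow> 'a rel" where
  "sep_modification r =
     {(p, q). p \<in> Field r \<and> q \<in> Field r \<and> (\<forall>s. (s, p) \<in> r \<longrightarrow> compatible r s q)}"

definition sep_equiv :: "'a rel \<Rightarrow> 'a rel" where
  "sep_equiv r = sep_modification r \<inter> (sep_modification r)\<inverse>"

definition sq :: "'a rel \<Rightarrow> 'a set rel" where
  "sq r = {(C, D). C \<in> Field r // sep_equiv r \<and> D \<in> Field r // sep_equiv r \<and>
     (\<exists>p\<in>C. \<exists>q\<in>D. (p, q) \<in> sep_modification r)}"

record 'a bool_alg =
  elems :: "'a set"
  bmeet :: "'a \<Rightarrow> 'a \<Rightarrow> 'a"
  bjoin :: "'a \<Rightarrow> 'a \<Rightarrow> 'a"
  bcompl :: "'a \<Rightarrow> 'a"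
  bzero :: 'a
  bone :: 'a

definition ba_isomorphic :: "'a bool_alg \<Rightarrow> 'b bool_alg \<Rightarrow> bool" where
  "ba_isomorphic A B \<longleftrightarrow> (\<exists>h. bij_betw h (elems A) (elems B) \<and>
     (\<forall>x\<in>elems A. \<forall>y\<in>elems A. h (bmeet A x y) = bmeet B (h x) (h y)) \<and>
     (\<forall>x\<in>elems A. \<forall>y\<in>elems A. h (bjoin A x y) = bjoin B (h x) (h y)) \<and>
     (\<forall>x\<in>elems A. h (bcompl A x) = bcompl B (h x)) \<and>
     h (bzero A) = bzero B \<and> h (bone A) = bone B)"

definition regular_open_algebra :: "'a topology \<Rightarrow> 'a set bool_alg" where
  "regular_open_algebra T = \<lparr>
     elems = {U. T interior_of (T closure_of U) = U},
     bmeet = (\<inter>),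
     bjoin = (\<lambda>U V. T interior_of (T closure_of (U \<union> V))),
     bcompl = (\<lambda>U. T interior_of (topspace T - U)),
     bzero = {},
     bone = topspace T\<rparr>"

definition down_topology :: "'a rel \<Rightarrow> 'a topology" where
  "down_topology r = topology (\<lambda>U. U \<subseteq> Field r \<and> (\<forall>q\<in>U. \<forall>p. (p, q) \<in> r \<longrightarrow> p \<in> U))"

lemma openin_down_topology:
  "openin (down_topology r) U \<longleftrightarrow> U \<subseteq> Field r \<and> (\<forall>q\<in>U. \<forall>p. (p, q) \<in> r \<longrightarrow> p \<in> U)"
proof -
  have "istopology (\<lambda>U. U \<subseteq> Field r \<and> (\<forall>q\<in>U. \<forall>p. (p, q) \<in> r \<longrightarrow> p \<in> U))"
    unfolding istopology_def by blast
  then show ?thesis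
    by (simp add: down_topology_def)
qed

definition ro :: "'a rel \<Rightarrow> 'a set bool_alg" where
  "ro r = regular_open_algebra (down_topology r)"

definition copies_completion :: "('i, 'x) rel_struct \<Rightarrow> 'x set set set bool_alg" where
  "copies_completion X = ro (sq (copies_poset X))"


section \<open>Sacks forcing and the Borel sets modulo countable sets\<close>

definition perfect :: "real set \<Rightarrow> bool" where
  "perfect P \<longleftrightarrow> P \<noteq> {} \<and> closed P \<and> (\<forall>x\<in>P. x islimpt P)"

definition sacks :: "real set rel" where
  "sacks = relation_of (\<subseteq>) {P. perfect P}"

definition eq_mod_countable :: "real set rel" where
  "eq_mod_countable =
     {(A, B). A \<in> sets borel \<and> B \<in> sets borel \<and> countable ((A - B) \<union> (B - A))}"

definition borel_mod_countable :: "real set set bool_alg" where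
  "borel_mod_countable = \<lparr>
     elems = sets borel // eq_mod_countable,
     bmeet = (\<lambda>a b. \<Union>A\<in>a. \<Union>B\<in>b. eq_mod_countable `` {A \<inter> B}),
     bjoin = (\<lambda>a b. \<Union>A\<in>a. \<Union>B\<in>b. eq_mod_countable `` {A \<union> B}),
     bcompl = (\<lambda>a. \<Union>A\<in>a. eq_mod_countable `` {- A}),
     bzero = eq_mod_countable `` {{}},
     bone = eq_mod_countable `` {UNIV}\<rparr>"

text \<open>A Boolean algebra viewed as a forcing notion consists of its nonzero elements; its regular
  open algebra is that of this poset.\<close>

definition positive_poset :: "'a bool_alg \<Rightarrow> 'a rel" where
  "positive_poset B = relation_of (\<lambda>a b. bmeet B a b = a) (elems B - {bzero B})"

end

theory Submission
  imports Defs
begin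

text \<open>Call a set of reals fat if it contains the range of a strictly increasing map \<open>\<real> \<rightarrow> \<real>\<close>. By the
  perfect set theorem for Borel sets, the perfect sets are dense both among the fat sets and among the
  Borel sets modulo countable sets, so all three posets have the same completion. If \<open>S\<close> is fat, the fat
  subsets of \<open>S\<close> yield this completion as well, by a Cantor--Bernstein argument.

  Let now \<open>X\<close> be chained by the order of \<open>S\<close>. Every fat subset of \<open>S\<close> contains an increasing image of
  \<open>S\<close>, hence a copy of \<open>X\<close>. Conversely, let \<open>f\<close> be a self-embedding of \<open>X\<close> and \<open>h = f \<circ> e\<close> with
  \<open>e : \<real> \<rightarrow> S\<close> increasing. If \<open>h\<close> has only countably many discontinuities, it is continuous on some
  perfect set and its range is fat. Otherwise infinitely many points have values of \<open>h\<close> on both sides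
  of a common level in each neighbourhood; the order patterns which \<open>h\<close> then realizes generate all
  permutations, and \<open>X\<close> is constant.\<close>

section \<open>Regular open algebras and dense embeddings\<close>

text \<open>Neither \<open>S\<close> nor a copy of \<open>X\<close> has to be measurable, so these
  sets cannot be handled as Borel sets. Being fat is an order-theoretic substitute for containing a
  perfect set: it passes to supersets and to increasing images without any measurability, and the
  perfect set theorem is applied only to Borel sets built on the way. The second obstacle is that
  chainedness makes increasing partial maps partial automorphisms of \<open>X\<close>, but not
  conversely: with a betweenness or cyclic order relation, self-embeddings may reverse or rotate the
  order. So \<open>f\<close> cannot be expected to be increasing, only tame enough to be continuous
  on a perfect set. Permutations matter because the truth of a relation at a tuple of distinct
  points depends only on the order pattern of the tuple; whenever \<open>f\<close> turns one pattern
  into another, the two have the same truth value, and adjacent transpositions connect all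
  patterns.\<close>

definition preord :: "'a rel \<Rightarrow> bool" where
  "preord r \<longleftrightarrow> (\<forall>p\<in>Field r. (p, p) \<in> r) \<and> trans r"

text \<open>The pseudocomplement in the lattice of open sets. The interior of the closure is its
  square, so all operations of \<open>ro\<close> can be written with it and the topology disappears
  from later arguments.\<close>

definition ro_neg :: "'a rel \<Rightarrow> 'a set \<Rightarrow> 'a set" where
  "ro_neg r U = {p \<in> Field r. \<forall>q. (q, p) \<in> r \<longrightarrow> q \<notin> U}"

section \<open>Regular open sets of the down topology\<close>

lemma topspace_down_topology [simp]: "topspace (down_topology r) = Field r"
proof -
  have "openin (down_topology r) (Field r)"
    by (auto simp: openin_down_topology intro: FieldI1)
  then show ?thesis
    by (auto simp: topspace_def openin_down_topology)
qed

lemma interior_of_down_topology: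
  assumes "preord r"
  shows "down_topology r interior_of V = {p \<in> Field r. \<forall>q. (q, p) \<in> r \<longrightarrow> q \<in> V}" (is "_ = ?I")
proof (rule interior_of_unique)
  show "?I \<subseteq> V" using assms by (auto simp: preord_def)
  show "openin (down_topology r) ?I"
    using assms unfolding openin_down_topology preord_def
    by (auto simp: Field_def dest: transD)
  show "W \<subseteq> ?I" if "W \<subseteq> V" "openin (down_topology r) W" for W
    using that unfolding openin_down_topology by blast
qed

lemma closure_of_down_topology:
  assumes "preord r"
  shows "down_topology r closure_of U = {p \<in> Field r. \<exists>q. (q, p) \<in> r \<and> q \<in> U}"
proof -
  have "down_topology r closure_of U
      = Field r - down_topology r interior_of (Field r - U)"
    by (metis closure_of_interior_of topspace_down_topology closure_of_restrict Diff_Int2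
        Int_Diff Int_absorb Int_commute)
  then show ?thesis
    by (auto simp: interior_of_down_topology[OF assms] Field_def)
qed

lemma ro_simps:
  assumes "preord r"
  shows "elems (ro r) = {U. ro_neg r (ro_neg r U) = U}"
    and "bmeet (ro r) = (\<inter>)"
    and "bjoin (ro r) = (\<lambda>U V. ro_neg r (ro_neg r U \<inter> ro_neg r V))"
    and "bcompl (ro r) = ro_neg r"
    and "bzero (ro r) = {}"
    and "bone (ro r) = Field r"
proof -
  have reg: "down_topology r interior_of (down_topology r closure_of U) = ro_neg r (ro_neg r U)" for U
    unfolding interior_of_down_topology[OF assms] closure_of_down_topology[OF assms] ro_neg_def
    by (auto simp: Field_def)
  show "elems (ro r) = {U. ro_neg r (ro_neg r U) = U}" "bmeet (ro r) = (\<inter>)"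
    "bzero (ro r) = {}" "bone (ro r) = Field r"
    by (simp_all add: ro_def regular_open_algebra_def reg)
  have "ro_neg r (U \<union> V) = ro_neg r U \<inter> ro_neg r V" for U V
    by (auto simp: ro_neg_def)
  then show "bjoin (ro r) = (\<lambda>U V. ro_neg r (ro_neg r U \<inter> ro_neg r V))"
    by (simp add: ro_def regular_open_algebra_def reg del: closure_of_Un)
  show "bcompl (ro r) = ro_neg r"
    unfolding ro_neg_def
    by (auto simp: ro_def regular_open_algebra_def fun_eq_iff
        interior_of_down_topology[OF assms] Field_def)
qed

lemma ro_neg_downward:
  assumes "preord r" "(q, p) \<in> r" "p \<in> ro_neg r U"
  shows "q \<in> ro_neg r U"
  using assms by (auto simp: ro_neg_def preord_def Field_def dest: transD)

lemma openin_ro_neg: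
  assumes "preord r"
  shows "openin (down_topology r) (ro_neg r U)"
  unfolding openin_down_topology
proof (intro conjI ballI allI impI)
  show "ro_neg r U \<subseteq> Field r" by (auto simp: ro_neg_def)
  show "p \<in> ro_neg r U" if "q \<in> ro_neg r U" "(p, q) \<in> r" for p q
    using ro_neg_downward[OF assms that(2,1)] .
qed

lemma ro_neg_antimono: "U \<subseteq> V \<Longrightarrow> ro_neg r V \<subseteq> ro_neg r U"
  by (auto simp: ro_neg_def)

lemma open_subset_double_ro_neg:
  assumes r: "preord r" and U: "openin (down_topology r) U"
  shows "U \<subseteq> ro_neg r (ro_neg r U)"
proof
  fix p assume p: "p \<in> U"
  have "q \<notin> ro_neg r U" if "(q, p) \<in> r" for q
  proof -
    have "q \<in> U" "(q, q) \<in> r"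
      using that U p r by (auto simp: openin_down_topology preord_def Field_def)
    then show ?thesis by (auto simp: ro_neg_def)
  qed
  then show "p \<in> ro_neg r (ro_neg r U)"
    using U p by (auto simp: ro_neg_def[of r "ro_neg r U"] openin_down_topology)
qed

text \<open>The usual Galois argument: \<open>ro_neg\<close> is antitone and its square is
  inflationary on open sets. Hence the double negation of any open set is a regular element.\<close>

lemma ro_neg_triple:
  assumes "preord r" "openin (down_topology r) U"
  shows "ro_neg r (ro_neg r (ro_neg r U)) = ro_neg r U"
proof
  show "ro_neg r (ro_neg r (ro_neg r U)) \<subseteq> ro_neg r U"
    using open_subset_double_ro_neg[OF assms] by (rule ro_neg_antimono)
  show "ro_neg r U \<subseteq> ro_neg r (ro_neg r (ro_neg r U))"
    using assms(1) openin_ro_neg[OF assms(1)] by (rule open_subset_double_ro_neg)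
qed

lemma ro_open:
  assumes "preord r" "U \<in> elems (ro r)"
  shows "openin (down_topology r) U"
proof -
  have "U = ro_neg r (ro_neg r U)" using assms by (simp add: ro_simps)
  then show ?thesis using openin_ro_neg[OF assms(1)] by metis
qed

lemma ro_closed:
  assumes r: "preord r" and U: "U \<in> elems (ro r)" and V: "V \<in> elems (ro r)"
  shows "bmeet (ro r) U V \<in> elems (ro r)" "bjoin (ro r) U V \<in> elems (ro r)"
    "bcompl (ro r) U \<in> elems (ro r)"
proof -
  have eq: "ro_neg r (ro_neg r U) = U" "ro_neg r (ro_neg r V) = V"
    using r U V by (auto simp: ro_simps)
  have "ro_neg r (ro_neg r (U \<inter> V)) \<subseteq> ro_neg r (ro_neg r U)"
    "ro_neg r (ro_neg r (U \<inter> V)) \<subseteq> ro_neg r (ro_neg r V)"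
    by (intro ro_neg_antimono; simp)+
  moreover have "U \<inter> V \<subseteq> ro_neg r (ro_neg r (U \<inter> V))"
    by (intro open_subset_double_ro_neg openin_Int ro_open r U V)
  ultimately show "bmeet (ro r) U V \<in> elems (ro r)"
    using eq r by (auto simp: ro_simps)
  show "bjoin (ro r) U V \<in> elems (ro r)"
    using r by (simp add: ro_simps ro_neg_triple openin_Int openin_ro_neg)
  show "bcompl (ro r) U \<in> elems (ro r)"
    using r eq by (simp add: ro_simps)
qed

lemma ro_constants_closed:
  assumes r: "preord r"
  shows "bzero (ro r) \<in> elems (ro r)" "bone (ro r) \<in> elems (ro r)"
proof -
  have "ro_neg r {} = Field r" "ro_neg r (Field r) = {}"
    using r by (auto simp: ro_neg_def preord_def)
  then show "bzero (ro r) \<in> elems (ro r)" "bone (ro r) \<in> elems (ro r)"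
    by (simp_all add: ro_simps[OF r])
qed

section \<open>Isomorphisms of completions and dense embeddings\<close>

lemma ba_isomorphic_trans:
  assumes "ba_isomorphic A B" "ba_isomorphic B C"
  shows "ba_isomorphic A C"
proof -
  obtain g where g: "bij_betw g (elems A) (elems B)"
     "\<forall>x\<in>elems A. \<forall>y\<in>elems A. g (bmeet A x y) = bmeet B (g x) (g y)"
     "\<forall>x\<in>elems A. \<forall>y\<in>elems A. g (bjoin A x y) = bjoin B (g x) (g y)"
     "\<forall>x\<in>elems A. g (bcompl A x) = bcompl B (g x)" "g (bzero A) = bzero B" "g (bone A) = bone B"
    using assms(1) unfolding ba_isomorphic_def by blast
  obtain h where h: "bij_betw h (elems B) (elems C)"
     "\<forall>x\<in>elems B. \<forall>y\<in>elems B. h (bmeet B x y) = bmeet C (h x) (h y)"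
     "\<forall>x\<in>elems B. \<forall>y\<in>elems B. h (bjoin B x y) = bjoin C (h x) (h y)"
     "\<forall>x\<in>elems B. h (bcompl B x) = bcompl C (h x)" "h (bzero B) = bzero C" "h (bone B) = bone C"
    using assms(2) unfolding ba_isomorphic_def by blast
  have "g x \<in> elems B" if "x \<in> elems A" for x
    using g(1) that by (auto simp: bij_betw_def)
  then show ?thesis
    unfolding ba_isomorphic_def
    using bij_betw_trans[OF g(1) h(1)] g(2-) h(2-)
    by (intro exI[of _ "h \<circ> g"]) auto
qed

text \<open>Symmetry is not automatic: \<open>ba_isomorphic\<close> speaks of bare records whose
  operations might leave the carrier, where the inverse map says nothing. For \<open>ro r\<close>
  closure is known, and closure on this one side suffices.\<close>

lemma ba_isomorphic_ro_sym:
  assumes "preord r" "ba_isomorphic (ro r) B"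
  shows "ba_isomorphic B (ro r)"
proof -
  let ?A = "ro r"
  obtain g where g: "bij_betw g (elems ?A) (elems B)"
     "\<And>x y. x \<in> elems ?A \<Longrightarrow> y \<in> elems ?A \<Longrightarrow> g (bmeet ?A x y) = bmeet B (g x) (g y)"
     "\<And>x y. x \<in> elems ?A \<Longrightarrow> y \<in> elems ?A \<Longrightarrow> g (bjoin ?A x y) = bjoin B (g x) (g y)"
     "\<And>x. x \<in> elems ?A \<Longrightarrow> g (bcompl ?A x) = bcompl B (g x)"
     "g (bzero ?A) = bzero B" "g (bone ?A) = bone B"
    using assms(2) unfolding ba_isomorphic_def by blast
  define h where "h = inv_into (elems ?A) g"
  have hg: "h (g x) = x" if "x \<in> elems ?A" for x
    using g(1) that by (simp add: h_def bij_betw_def)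
  have onto: "\<exists>x. x \<in> elems ?A \<and> y = g x" if "y \<in> elems B" for y
    using g(1) that by (auto simp: bij_betw_def)
  note cl = ro_closed[OF assms(1)] ro_constants_closed[OF assms(1)]
  have "bij_betw h (elems B) (elems ?A)"
    unfolding h_def using g(1) by (rule bij_betw_inv_into)
  moreover have "h (bmeet B x y) = bmeet ?A (h x) (h y)" "h (bjoin B x y) = bjoin ?A (h x) (h y)"
      if "x \<in> elems B" "y \<in> elems B" for x y
    using onto[OF that(1)] onto[OF that(2)] by (auto simp flip: g(2,3) simp: hg cl)
  moreover have "h (bcompl B x) = bcompl ?A (h x)" if "x \<in> elems B" for x
    using onto[OF that] by (auto simp flip: g(4) simp: hg cl)
  moreover have "h (bzero B) = bzero ?A" "h (bone B) = bone ?A"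
    by (auto simp flip: g(5,6) simp: hg cl)
  ultimately show ?thesis
    unfolding ba_isomorphic_def by blast
qed

text \<open>Compatibility is reflected, the order itself need not be, so the map may identify
  elements. This is what allows classes modulo countable sets and separative quotients as
  targets.\<close>

definition dense_embedding :: "'a rel \<Rightarrow> 'b rel \<Rightarrow> ('a \<Rightarrow> 'b) \<Rightarrow> bool" where
  "dense_embedding r s f \<longleftrightarrow>
     (\<forall>p q. (p, q) \<in> r \<longrightarrow> (f p, f q) \<in> s) \<and>
     (\<forall>p\<in>Field r. \<forall>q\<in>Field r. compatible s (f p) (f q) \<longrightarrow> compatible r p q) \<and>
     (\<forall>b\<in>Field s. \<exists>p\<in>Field r. (f p, b) \<in> s)"

text \<open>Taking preimages is the isomorphism, hence the direction from \<open>s\<close> to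
  \<open>r\<close>. Once it commutes with \<open>ro_neg\<close> on open sets, joins and complements
  follow, since both are expressed by \<open>ro_neg\<close> and intersection.\<close>

lemma ba_isomorphic_dense_embedding:
  assumes r: "preord r" and s: "preord s" and f: "dense_embedding r s f"
  shows "ba_isomorphic (ro s) (ro r)"
proof -
  define h where "h V = {p \<in> Field r. f p \<in> V}" for V
  have fF: "f p \<in> Field s" if "p \<in> Field r" for p
    using that r f unfolding preord_def dense_embedding_def Field_def by blast
  have mono: "(f p, f q) \<in> s" if "(p, q) \<in> r" for p q
    using f that by (auto simp: dense_embedding_def)
  have comp: "\<exists>t. (t, p) \<in> r \<and> (t, q) \<in> r"
    if "p \<in> Field r" "q \<in> Field r" "(b, f p) \<in> s" "(b, f q) \<in> s" for p q b
    using f that unfolding dense_embedding_def compatible_def by blast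
  have dens: "\<exists>p\<in>Field r. (f p, b) \<in> s" if "b \<in> Field s" for b
    using f that by (auto simp: dense_embedding_def)
  have tr: "(a, c) \<in> s" if "(a, b) \<in> s" "(b, c) \<in> s" for a b c
    using s that by (auto simp: preord_def dest: transD)
  have h_neg: "h (ro_neg s V) = ro_neg r (h V)" if V: "openin (down_topology s) V" for V
  proof (intro equalityI subsetI)
    fix p assume "p \<in> h (ro_neg s V)"
    then show "p \<in> ro_neg r (h V)"
      using mono by (auto simp: h_def ro_neg_def)
  next
    fix p assume p: "p \<in> ro_neg r (h V)"
    \<comment> \<open>Density yields \<open>f p'\<close> below \<open>b\<close>, so
      \<open>f p\<close> and \<open>f p'\<close> are compatible; reflecting this gives
      \<open>t\<close> below \<open>p\<close> and \<open>p'\<close>, and \<open>f t\<close> lies in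
      \<open>V\<close> against the choice of \<open>p\<close>.\<close>
    have "b \<notin> V" if b: "(b, f p) \<in> s" for b
    proof
      assume bV: "b \<in> V"
      obtain p' where p': "p' \<in> Field r" "(f p', b) \<in> s"
        using dens[of b] b by (auto simp: Field_def)
      then obtain t where t: "(t, p) \<in> r" "(t, p') \<in> r"
        using comp[of p p' "f p'"] p b tr s fF unfolding preord_def ro_neg_def by blast
      have "(f t, b) \<in> s" using mono[OF t(2)] p'(2) tr by blast
      then have "f t \<in> V" using V bV by (auto simp: openin_down_topology)
      then show False using p t(1) by (auto simp: h_def ro_neg_def Field_def)
    qed
    then show "p \<in> h (ro_neg s V)"
      using p fF by (auto simp: h_def ro_neg_def)
  qed
  note neg_open = openin_ro_neg[OF s]
  have op: "openin (down_topology s) V" if "V \<in> elems (ro s)" for V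
    using ro_open[OF s that] .
  have h_elem: "h V \<in> elems (ro r)" if "V \<in> elems (ro s)" for V
    using that op[OF that] h_neg neg_open by (metis (mono_tags, lifting) mem_Collect_eq r ro_simps(1) s)
  have inj: "V \<subseteq> V'" if V: "V \<in> elems (ro s)" and V': "V' \<in> elems (ro s)" and "h V \<subseteq> h V'" for V V'
  proof
    fix b assume b: "b \<in> V"
    have "b \<in> ro_neg s (ro_neg s V')"
    proof -
      have "c \<notin> ro_neg s V'" if c: "(c, b) \<in> s" for c
      proof
        assume c': "c \<in> ro_neg s V'"
        obtain p where p: "p \<in> Field r" "(f p, c) \<in> s"
          using dens[of c] c by (auto simp: Field_def)
        then have "f p \<in> V" using op[OF V] b c tr unfolding openin_down_topology by blast
        then have "f p \<in> V'" using \<open>h V \<subseteq> h V'\<close> p(1) by (auto simp: h_def)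
        then show False using c' p(2) by (auto simp: ro_neg_def)
      qed
      moreover have "b \<in> Field s" using op[OF V] b by (auto simp: openin_down_topology)
      ultimately show ?thesis by (auto simp: ro_neg_def[of s "ro_neg s V'"])
    qed
    then show "b \<in> V'" using V' s by (simp add: ro_simps)
  qed
  have surj: "\<exists>V\<in>elems (ro s). h V = U" if U: "U \<in> elems (ro r)" for U
  proof -
    \<comment> \<open>\<open>W\<close> is the open set generated by the image of \<open>U\<close>.
      It need not be regular, but its preimage is already \<open>U\<close>, so its double negation
      is a regular preimage partner of \<open>U\<close>.\<close>
    define W where "W = {b \<in> Field s. \<exists>p\<in>U. (b, f p) \<in> s}"
    have oW: "openin (down_topology s) W"
      unfolding openin_down_topology W_def using tr by (auto simp: Field_def)
    have oU: "openin (down_topology r) U" using ro_open[OF r U] .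
    have rU: "ro_neg r (ro_neg r U) = U" using U r by (simp add: ro_simps)
    have "U \<subseteq> h W"
    proof
      fix x assume x: "x \<in> U"
      then have "x \<in> Field r" using oU by (auto simp: openin_down_topology)
      then have "x \<in> Field r" "f x \<in> Field s" "(f x, f x) \<in> s"
        using fF s by (auto simp: preord_def)
      with x show "x \<in> h W" unfolding h_def W_def by blast
    qed
    moreover have "h W \<subseteq> ro_neg r (ro_neg r U)"
    proof
      fix p assume "p \<in> h W"
      then obtain p0 where p: "p \<in> Field r" "p0 \<in> U" "(f p, f p0) \<in> s"
        by (auto simp: h_def W_def)
      have "\<exists>t. (t, p') \<in> r \<and> t \<in> U" if p': "(p', p) \<in> r" for p'
      proof -
        have F: "p' \<in> Field r" "p0 \<in> Field r"
          using p' p oU by (auto simp: Field_def openin_down_topology)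
        have "(f p', f p0) \<in> s" using mono[OF p'] p(3) tr by blast
        then have "\<exists>t. (t, p') \<in> r \<and> (t, p0) \<in> r"
          using comp[OF F, of "f p'"] s fF[OF F(1)] by (auto simp: preord_def)
        then show ?thesis using oU p(2) unfolding openin_down_topology by blast
      qed
      then show "p \<in> ro_neg r (ro_neg r U)" using p(1) unfolding ro_neg_def by blast
    qed
    ultimately have "h W = U" using rU by blast
    then have "h (ro_neg s (ro_neg s W)) = U"
      using h_neg[OF neg_open] h_neg[OF oW] rU by simp
    moreover have "ro_neg s (ro_neg s W) \<in> elems (ro s)"
      using s oW by (simp add: ro_simps ro_neg_triple)
    ultimately show ?thesis by blast
  qed
  have "bij_betw h (elems (ro s)) (elems (ro r))"
    unfolding bij_betw_def
  proof (intro conjI inj_onI)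
    show "V = V'" if "V \<in> elems (ro s)" "V' \<in> elems (ro s)" "h V = h V'" for V V'
      using inj that by blast
    show "h ` elems (ro s) = elems (ro r)"
      using h_elem surj by blast
  qed
  moreover have "h (V \<inter> V') = h V \<inter> h V'" for V V'
    by (auto simp: h_def)
  moreover have "h (ro_neg s (ro_neg s V \<inter> ro_neg s V')) = ro_neg r (ro_neg r (h V) \<inter> ro_neg r (h V'))"
    if "V \<in> elems (ro s)" "V' \<in> elems (ro s)" for V V'
  proof -
    have "h (ro_neg s (ro_neg s V \<inter> ro_neg s V')) = ro_neg r (h (ro_neg s V) \<inter> h (ro_neg s V'))"
      by (subst h_neg) (auto simp: neg_open h_def intro!: arg_cong[of _ _ "ro_neg r"])
    then show ?thesis using h_neg[OF op] that by simp
  qed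
  moreover have "h {} = {}" "h (Field s) = Field r"
    using fF by (auto simp: h_def)
  ultimately show ?thesis
    unfolding ba_isomorphic_def ro_simps(2-)[OF r] ro_simps(2-)[OF s] using h_neg[OF op]
    by (intro exI[of _ h]) blast
qed

section \<open>The separative quotient\<close>

lemma sep_modification_trans:
  assumes r: "preord r"
  shows "trans (sep_modification r)"
proof (rule transI)
  fix p q t assume pq: "(p, q) \<in> sep_modification r" and qt: "(q, t) \<in> sep_modification r"
  have "compatible r a t" if a: "(a, p) \<in> r" for a
  proof -
    obtain b where b: "(b, a) \<in> r" "(b, q) \<in> r"
      using pq a by (auto simp: sep_modification_def compatible_def)
    then obtain c where "(c, b) \<in> r" "(c, t) \<in> r"
      using qt by (auto simp: sep_modification_def compatible_def)
    with b r show ?thesis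
      by (auto simp: compatible_def preord_def dest: transD)
  qed
  then show "(p, t) \<in> sep_modification r"
    using pq qt by (auto simp: sep_modification_def)
qed

lemma sep_modificationI:
  assumes "preord r" "(p, q) \<in> r"
  shows "(p, q) \<in> sep_modification r"
proof -
  have "compatible r a q" if "(a, p) \<in> r" for a
  proof -
    have "(a, a) \<in> r" "(a, q) \<in> r"
      using assms that by (auto simp: preord_def Field_def dest: transD)
    then show ?thesis by (auto simp: compatible_def)
  qed
  then show ?thesis using assms(2) by (auto simp: sep_modification_def Field_def)
qed

lemma sep_modification_refl:
  assumes "preord r" "p \<in> Field r"
  shows "(p, p) \<in> sep_modification r"
  using assms by (intro sep_modificationI) (auto simp: preord_def)

lemma equiv_sep_equiv:
  assumes "preord r"
  shows "equiv (Field r) (sep_equiv r)"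
proof (rule equivI)
  show "sep_equiv r \<subseteq> Field r \<times> Field r"
    by (auto simp: sep_equiv_def sep_modification_def)
  show "refl_on (Field r) (sep_equiv r)"
    using assms by (auto simp: refl_on_def sep_equiv_def preord_def intro: sep_modificationI[OF assms])
  show "sym (sep_equiv r)" by (auto simp: sym_def sep_equiv_def)
  show "trans (sep_equiv r)"
    using sep_modification_trans[OF assms] unfolding sep_equiv_def trans_def by blast
qed

lemma sq_iff:
  assumes r: "preord r" and p: "p \<in> Field r" "q \<in> Field r"
  shows "(sep_equiv r `` {p}, sep_equiv r `` {q}) \<in> sq r \<longleftrightarrow> (p, q) \<in> sep_modification r"
proof -
  have self: "p \<in> sep_equiv r `` {p}" "q \<in> sep_equiv r `` {q}"
    using equiv_class_self[OF equiv_sep_equiv[OF r]] p by auto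
  have "(p, q) \<in> sep_modification r"
    if "(p, p') \<in> sep_equiv r" "(q, q') \<in> sep_equiv r" "(p', q') \<in> sep_modification r" for p' q'
    using that sep_modification_trans[OF r] unfolding sep_equiv_def trans_def by blast
  then show ?thesis
    unfolding sq_def using self p by (auto intro: quotientI)
qed

lemma sq_cases:
  assumes r: "preord r" and "(C, D) \<in> sq r"
  obtains p q where "p \<in> Field r" "q \<in> Field r" "C = sep_equiv r `` {p}" "D = sep_equiv r `` {q}"
    "(p, q) \<in> sep_modification r"
proof -
  obtain p q where "p \<in> Field r" "q \<in> Field r" "C = sep_equiv r `` {p}" "D = sep_equiv r `` {q}"
    using assms(2) by (auto simp: sq_def elim!: quotientE)
  with that assms(2) show ?thesis by (metis sq_iff[OF r])
qed

lemma Field_sq: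
  assumes r: "preord r"
  shows "Field (sq r) = Field r // sep_equiv r"
proof -
  have "(C, C) \<in> sq r" if C: "C \<in> Field r // sep_equiv r" for C
  proof -
    from C obtain p where "C = sep_equiv r `` {p}" "p \<in> Field r"
      by (rule quotientE)
    then show ?thesis
      by (simp add: sq_iff[OF r] sep_modification_refl[OF r])
  qed
  moreover have "Field (sq r) \<subseteq> Field r // sep_equiv r"
    by (auto simp: sq_def Field_def)
  ultimately show ?thesis by (auto intro: FieldI1)
qed

lemma preord_sq:
  assumes r: "preord r"
  shows "preord (sq r)"
  unfolding preord_def
proof (intro conjI ballI)
  fix C assume "C \<in> Field (sq r)"
  then obtain p where "C = sep_equiv r `` {p}" "p \<in> Field r"
    unfolding Field_sq[OF r] by (rule quotientE)
  then show "(C, C) \<in> sq r"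
    by (simp add: sq_iff[OF r] sep_modification_refl[OF r])
next
  show "trans (sq r)"
  proof (rule transI)
    fix C D E assume CDE: "(C, D) \<in> sq r" "(D, E) \<in> sq r"
    then have Q: "C \<in> Field r // sep_equiv r" "D \<in> Field r // sep_equiv r" "E \<in> Field r // sep_equiv r"
      by (auto simp: sq_def)
    from Q(1) obtain p where p: "C = sep_equiv r `` {p}" "p \<in> Field r" by (rule quotientE)
    from Q(2) obtain q where q: "D = sep_equiv r `` {q}" "q \<in> Field r" by (rule quotientE)
    from Q(3) obtain t where t: "E = sep_equiv r `` {t}" "t \<in> Field r" by (rule quotientE)
    show "(C, E) \<in> sq r"
      using CDE transD[OF sep_modification_trans[OF r], of p q t] p q t by (simp add: sq_iff[OF r])
  qed
qed

text \<open>Incompatibility survives the quotient: a common lower bound in the separative order is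
  refined twice, first below \<open>p\<close>, then below \<open>q\<close>, to a common lower bound
  in \<open>r\<close>.\<close>

lemma dense_embedding_sq:
  assumes r: "preord r"
  shows "dense_embedding r (sq r) (\<lambda>p. sep_equiv r `` {p})"
  unfolding dense_embedding_def
proof (intro conjI allI ballI impI)
  show "(sep_equiv r `` {p}, sep_equiv r `` {q}) \<in> sq r" if pq: "(p, q) \<in> r" for p q
    using sq_iff[OF r FieldI1[OF pq] FieldI2[OF pq]] sep_modificationI[OF r pq] by simp
next
  fix C assume C: "C \<in> Field (sq r)"
  then obtain p where "C = sep_equiv r `` {p}" "p \<in> Field r"
    unfolding Field_sq[OF r] by (rule quotientE)
  moreover have "(C, C) \<in> sq r" using preord_sq[OF r] C unfolding preord_def by blast
  ultimately show "\<exists>p\<in>Field r. (sep_equiv r `` {p}, C) \<in> sq r" by blast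
next
  fix p q assume F: "p \<in> Field r" "q \<in> Field r"
    and "compatible (sq r) (sep_equiv r `` {p}) (sep_equiv r `` {q})"
  then obtain C where C: "(C, sep_equiv r `` {p}) \<in> sq r" "(C, sep_equiv r `` {q}) \<in> sq r"
    by (auto simp: compatible_def)
  then obtain t where t: "t \<in> Field r" "C = sep_equiv r `` {t}"
    by (auto elim: sq_cases[OF r])
  with C F have "(t, p) \<in> sep_modification r" "(t, q) \<in> sep_modification r"
    by (simp_all add: sq_iff[OF r])
  moreover have "(t, t) \<in> r" using r t by (simp add: preord_def)
  ultimately obtain a where a: "(a, t) \<in> r" "(a, p) \<in> r"
    by (auto simp: sep_modification_def compatible_def)
  with \<open>(t, q) \<in> sep_modification r\<close> obtain b where "(b, a) \<in> r" "(b, q) \<in> r"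
    by (auto simp: sep_modification_def compatible_def)
  then show "compatible r p q"
    using r a by (auto simp: compatible_def preord_def dest: transD)
qed

section \<open>Families of sets ordered by inclusion\<close>

lemma Field_relation_of_subset [simp]: "Field (relation_of (\<subseteq>) \<A>) = \<A>"
proof (intro equalityI subsetI)
  show "A \<in> \<A>" if "A \<in> Field (relation_of (\<subseteq>) \<A>)" for A
    using that unfolding Field_def relation_of_def by blast
  show "A \<in> Field (relation_of (\<subseteq>) \<A>)" if "A \<in> \<A>" for A
    using that by (intro FieldI1[of A A]) (simp add: relation_of_def)
qed

lemma preord_relation_of_subset: "preord (relation_of (\<subseteq>) \<A>)"
  unfolding preord_def Field_relation_of_subset
  by (auto simp: relation_of_def trans_def)

lemma ba_isomorphic_ro_sq:
  assumes "preord r"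
  shows "ba_isomorphic (ro (sq r)) (ro r)"
  using ba_isomorphic_dense_embedding[OF assms preord_sq[OF assms] dense_embedding_sq[OF assms]] .

lemma dense_embedding_family:
  assumes "\<And>A. A \<in> \<A> \<Longrightarrow> f A \<in> \<B>"
    and "\<And>A A'. A \<in> \<A> \<Longrightarrow> A' \<in> \<A> \<Longrightarrow> A \<subseteq> A' \<Longrightarrow> f A \<subseteq> f A'"
    and "\<And>A A' B. A \<in> \<A> \<Longrightarrow> A' \<in> \<A> \<Longrightarrow> B \<in> \<B> \<Longrightarrow> B \<subseteq> f A \<Longrightarrow> B \<subseteq> f A' \<Longrightarrow> \<exists>C\<in>\<A>. C \<subseteq> A \<and> C \<subseteq> A'"
    and "\<And>B. B \<in> \<B> \<Longrightarrow> \<exists>A\<in>\<A>. f A \<subseteq> B"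
  shows "dense_embedding (relation_of (\<subseteq>) \<A>) (relation_of (\<subseteq>) \<B>) f"
  unfolding dense_embedding_def Field_relation_of_subset
proof (intro conjI allI impI ballI)
  show "(f A, f A') \<in> relation_of (\<subseteq>) \<B>" if "(A, A') \<in> relation_of (\<subseteq>) \<A>" for A A'
    using that assms(1,2) by (simp add: relation_of_def)
  show "\<exists>A\<in>\<A>. (f A, B) \<in> relation_of (\<subseteq>) \<B>" if "B \<in> \<B>" for B
    using assms(1) assms(4)[OF that] that by (auto simp: relation_of_def)
  show "compatible (relation_of (\<subseteq>) \<A>) A A'"
    if A: "A \<in> \<A>" "A' \<in> \<A>" and AA': "compatible (relation_of (\<subseteq>) \<B>) (f A) (f A')" for A A'
  proof -
    obtain B where B: "B \<in> \<B>" "B \<subseteq> f A" "B \<subseteq> f A'"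
      using AA' by (auto simp: compatible_def relation_of_def)
    obtain C where "C \<in> \<A>" "C \<subseteq> A" "C \<subseteq> A'" using assms(3)[OF A B] by metis
    then show ?thesis using A by (auto simp: compatible_def relation_of_def)
  qed
qed

section \<open>The perfect set theorem for Borel sets\<close>

text \<open>By \<open>perfect_fat\<close> and \<open>fat_contains_perfect\<close> this amounts to
  containing a perfect set; the form with an increasing map is the one that increasing functions
  preserve.\<close>

definition fat :: "real set \<Rightarrow> bool" where
  "fat A \<longleftrightarrow> (\<exists>e::real \<Rightarrow> real. strict_mono e \<and> range e \<subseteq> A)"

text \<open>This is analyticity. Real sequences serve as the space above \<real> because countably
  many witnesses can again be coded in one sequence, so unions and intersections stay in the same
  type.\<close>

definition projects_onto :: "(nat \<Rightarrow> real) set \<Rightarrow> real set \<Rightarrow> bool" where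
  "projects_onto C A \<longleftrightarrow> closed C \<and> (\<lambda>s. s 0) ` C = A"

lemma continuous_on_coord [continuous_intros]:
  "continuous_on S (\<lambda>s. s i)" for S :: "('i \<Rightarrow> 'b::topological_space) set"
  by (rule continuous_on_subset[OF continuous_on_product_coordinates subset_UNIV])

lemma projects_onto_UN:
  assumes "\<And>n. projects_onto (C n) (A n)"
  shows "\<exists>C. projects_onto C (\<Union>n::nat. A n)"
proof -
  \<comment> \<open>\<open>T\<close> deletes coordinate 1, which is thereby free to carry an index,
    and keeps coordinate 0, the projected point.\<close>
  define T where "T = (\<lambda>(s :: nat \<Rightarrow> real) k. if k = 0 then s 0 else s (Suc k))"
  have T: "continuous_on UNIV T"
  proof (rule continuous_on_coordinatewise_then_product)
    show "continuous_on UNIV (\<lambda>s. T s k)" for k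
      by (cases k) (simp_all add: T_def continuous_on_coord)
  qed
  \<comment> \<open>The coordinate \<open>s 1\<close> names the member of the union; the bound \<open>1/2\<close> replaces the condition
    \<open>s 1 \<noteq> n\<close>, which is not closed.\<close>
  define D where "D = {s. s 1 \<in> range real} \<inter> (\<Inter>n. {s. \<bar>s 1 - real n\<bar> \<ge> 1/2} \<union> T -` C n)"
  have "closed (range real)"
    using closed_Nats[where 'a=real] by (simp add: Nats_def)
  then have "closed {s :: nat \<Rightarrow> real. s 1 \<in> range real}"
    using closed_vimage[of "range real" "\<lambda>s::nat \<Rightarrow> real. s 1", OF _ continuous_on_coord]
    by (simp add: vimage_def)
  moreover have "closed {s :: nat \<Rightarrow> real. \<bar>s 1 - real n\<bar> \<ge> 1/2}" for n
    by (intro closed_Collect_le continuous_intros)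
  moreover have "closed (T -` C n)" for n
    using assms[of n] T unfolding projects_onto_def by (auto intro: closed_vimage)
  ultimately have "closed D"
    unfolding D_def by (intro closed_Int closed_INT closed_Un) auto
  moreover have "(\<lambda>s. s 0) ` D = (\<Union>n. A n)"
  proof (intro equalityI subsetI)
    fix x assume "x \<in> (\<lambda>s. s 0) ` D"
    then obtain s n where s: "s \<in> D" "x = s 0" "s 1 = real n" by (auto simp: D_def)
    then have "T s \<in> C n" by (force simp: D_def)
    then have "T s 0 \<in> A n" using assms[of n] by (auto simp: projects_onto_def)
    then show "x \<in> (\<Union>n. A n)" using s by (auto simp: T_def)
  next
    fix x assume "x \<in> (\<Union>n. A n)"
    then obtain n where "x \<in> A n" by blast
    then obtain t where t: "t \<in> C n" "x = t 0"
      using assms[of n] unfolding projects_onto_def by blast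
    define s where "s = (\<lambda>k. if k = 0 then t 0 else if k = 1 then real n else t (k - 1))"
    have "T s = t" by (auto simp: T_def s_def)
    moreover have "\<bar>real n - real m\<bar> \<ge> 1/2" if "m \<noteq> n" for m
      using that by linarith
    ultimately have "s \<in> {s. \<bar>s 1 - real m\<bar> \<ge> 1/2} \<union> T -` C m" for m
      using t(1) by (cases "m = n") (auto simp: s_def)
    then have "s \<in> D" by (auto simp: D_def s_def)
    moreover have "x = s 0" using t(2) by (simp add: s_def)
    ultimately show "x \<in> (\<lambda>s. s 0) ` D" by blast
  qed
  ultimately show ?thesis unfolding projects_onto_def by blast
qed

lemma projects_onto_INT:
  assumes "\<And>n. projects_onto (C n) (A n)"
  shows "\<exists>C. projects_onto C (\<Inter>n::nat. A n)"
proof -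
  \<comment> \<open>\<open>T n\<close> reads off the \<open>n\<close>-th of countably many
    interleaved witnesses; they share coordinate 0, and \<open>Suc\<close> keeps the interleaving
    away from it.\<close>
  define T where "T = (\<lambda>n (s :: nat \<Rightarrow> real) k. if k = 0 then s 0 else s (Suc (prod_encode (n, k))))"
  have T: "continuous_on UNIV (T n)" for n
  proof (rule continuous_on_coordinatewise_then_product)
    show "continuous_on UNIV (\<lambda>s. T n s k)" for k
      by (cases k) (simp_all add: T_def continuous_on_coord)
  qed
  define D where "D = (\<Inter>n. T n -` C n)"
  have "closed (T n -` C n)" for n
    using assms[of n] T unfolding projects_onto_def by (auto intro: closed_vimage)
  then have "closed D"
    unfolding D_def by (intro closed_INT) auto
  moreover have "(\<lambda>s. s 0) ` D = (\<Inter>n. A n)"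
  proof (intro equalityI subsetI)
    fix x assume "x \<in> (\<lambda>s. s 0) ` D"
    then obtain s where s: "s \<in> D" "x = s 0" by auto
    have "T n s 0 \<in> A n" for n using assms[of n] s by (auto simp: projects_onto_def D_def)
    then show "x \<in> (\<Inter>n. A n)" using s by (auto simp: T_def)
  next
    fix x assume x: "x \<in> (\<Inter>n. A n)"
    have "\<exists>t. t \<in> C n \<and> x = t 0" for n
      using assms[of n] x by (auto simp: projects_onto_def)
    then obtain t where t: "\<And>n. t n \<in> C n" "\<And>n. x = t n 0" by metis
    define s where "s = (\<lambda>k. if k = 0 then x else case prod_decode (k - 1) of (n, j) \<Rightarrow> t n j)"
    have "T n s = t n" for n using t(2)[of n] by (auto simp: T_def s_def)
    then have "s \<in> D" using t(1) by (auto simp: D_def)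
    moreover have "x = s 0" by (simp add: s_def)
    ultimately show "x \<in> (\<lambda>s. s 0) ` D" by blast
  qed
  ultimately show ?thesis unfolding projects_onto_def by blast
qed

lemma projects_onto_borel:
  assumes "A \<in> sets (borel :: real measure)"
  shows "\<exists>C. projects_onto C A"
proof -
  have "A \<in> sigma_sets UNIV (range (\<lambda>a::real. {..a}))"
    using assms by (simp add: borel_eq_atMost)
  \<comment> \<open>Analytic sets are not closed under complements, so the induction carries the
    complement along; the complement step then only swaps the two halves.\<close>
  then have "(\<exists>C. projects_onto C A) \<and> (\<exists>C. projects_onto C (- A))"
  proof induction
    case (Basic A)
    then obtain a where A: "A = {..a}" by auto
    have "projects_onto {s. s 0 \<le> a} {..a}"
    proof -
      have "closed {s :: nat \<Rightarrow> real. s 0 \<le> a}" by (intro closed_Collect_le continuous_intros)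
      moreover have "x \<in> (\<lambda>s. s 0) ` {s :: nat \<Rightarrow> real. s 0 \<le> a}" if "x \<le> a" for x
        using that by (intro image_eqI[of _ _ "\<lambda>_. x"]) auto
      ultimately show ?thesis by (auto simp: projects_onto_def)
    qed
    \<comment> \<open>The strict inequality is not a closed condition; coordinate 1 witnesses it as
      the reciprocal of \<open>s 0 - a\<close>, which cuts out a closed branch of a
      hyperbola.\<close>
    moreover have "projects_onto {s. (s 0 - a) * s 1 = 1 \<and> 0 \<le> s 1} {a<..}"
    proof -
      have "closed {s :: nat \<Rightarrow> real. (s 0 - a) * s 1 = 1 \<and> 0 \<le> s 1}"
        by (intro closed_Collect_conj closed_Collect_eq closed_Collect_le continuous_intros)
      moreover have "a < s 0" if "(s 0 - a) * s 1 = 1" "0 \<le> s 1" for s :: "nat \<Rightarrow> real"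
        using that by (smt (verit) mult_nonpos_nonneg)
      moreover have "x \<in> (\<lambda>s. s 0) ` {s :: nat \<Rightarrow> real. (s 0 - a) * s 1 = 1 \<and> 0 \<le> s 1}" if "a < x" for x
        using that by (intro image_eqI[of _ _ "\<lambda>k. if k = 0 then x else 1 / (x - a)"]) auto
      ultimately show ?thesis unfolding projects_onto_def by blast
    qed
    moreover have "- A = {a<..}" using A by auto
    ultimately show ?case unfolding \<open>- A = {a<..}\<close> unfolding A by blast
  next
    case Empty
    have "x \<in> range (\<lambda>s :: nat \<Rightarrow> real. s 0)" for x
      by (rule image_eqI[of _ _ "\<lambda>_. x"]) auto
    then have "projects_onto {} {}" "projects_onto UNIV UNIV"
      unfolding projects_onto_def by auto
    then show ?case unfolding Compl_empty_eq by blast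
  next
    case (Compl A)
    then show ?case unfolding Compl_eq_Diff_UNIV[symmetric] double_complement by blast
  next
    case (Union A)
    then have "\<forall>n. \<exists>C. projects_onto C (A n)" "\<forall>n. \<exists>D. projects_onto D (- A n)" by blast+
    then obtain C D where "\<And>n. projects_onto (C n) (A n)" "\<And>n. projects_onto (D n) (- A n)"
      unfolding choice_iff by blast
    then show ?case
      using projects_onto_UN[of C A] projects_onto_INT[of D "\<lambda>n. - A n"] unfolding Compl_UN by blast
  qed
  then show ?thesis ..
qed

text \<open>Only countably much of the image is lost when all basic open sets with countable image
  are removed. Near any remaining point the image is uncountable, so two such points with different
  values yield the two pieces.\<close>

lemma uncountable_closed_split:
  fixes \<pi> :: "'a::polish_space \<Rightarrow> real"
  assumes \<pi>: "continuous_on UNIV \<pi>" and E: "closed E" "uncountable (\<pi> ` E)" and "0 < \<epsilon>"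
  shows "\<exists>F G c. closed F \<and> closed G \<and> F \<subseteq> E \<and> G \<subseteq> E \<and> uncountable (\<pi> ` F) \<and> uncountable (\<pi> ` G) \<and>
     (\<forall>x\<in>F. \<forall>y\<in>F. dist x y < \<epsilon>) \<and> (\<forall>x\<in>G. \<forall>y\<in>G. dist x y < \<epsilon>) \<and>
     (\<forall>x\<in>F. \<pi> x < c) \<and> (\<forall>x\<in>G. c < \<pi> x)"
proof -
  obtain B :: "'a set set" where B: "countable B" "topological_basis B"
    using ex_countable_basis by auto
  define N where "N = {b \<in> B. countable (\<pi> ` (E \<inter> b))}"
  have "countable N" unfolding N_def using B(1) by auto
  then have "countable (\<Union>b\<in>N. \<pi> ` (E \<inter> b))" by (auto simp: N_def)
  moreover have "\<pi> ` E = \<pi> ` (E - \<Union>N) \<union> (\<Union>b\<in>N. \<pi> ` (E \<inter> b))" by blast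
  ultimately have unc: "uncountable (\<pi> ` (E - \<Union>N))" using E(2) by (metis countable_Un)
  have "\<exists>x y. x \<in> E - \<Union>N \<and> y \<in> E - \<Union>N \<and> \<pi> x < \<pi> y"
  proof (rule ccontr)
    assume no: "\<not> ?thesis"
    have "E - \<Union>N \<noteq> {}" using unc by (metis countable_empty image_empty)
    then obtain x where x: "x \<in> E - \<Union>N" by blast
    have "\<pi> ` (E - \<Union>N) \<subseteq> {\<pi> x}"
    proof
      fix v assume "v \<in> \<pi> ` (E - \<Union>N)"
      then obtain y where "y \<in> E - \<Union>N" "v = \<pi> y" by auto
      then have "\<not> \<pi> x < \<pi> y" "\<not> \<pi> y < \<pi> x" using no x by blast+
      then show "v \<in> {\<pi> x}" using \<open>v = \<pi> y\<close> by simp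
    qed
    then have "countable (\<pi> ` (E - \<Union>N))" by (rule countable_subset) simp
    then show False using unc by simp
  qed
  then obtain x y where xy: "x \<in> E - \<Union>N" "y \<in> E - \<Union>N" "\<pi> x < \<pi> y" by blast
  define c where "c = (\<pi> x + \<pi> y) / 2"
  have piece: "\<exists>F. closed F \<and> F \<subseteq> E \<and> uncountable (\<pi> ` F) \<and> (\<forall>x\<in>F. \<forall>y\<in>F. dist x y < \<epsilon>) \<and> F \<subseteq> U"
    if z: "z \<in> E - \<Union>N" "z \<in> U" and U: "open U" for z U
  proof -
    obtain d where d: "0 < d" "ball z d \<subseteq> U" using U z(2) by (meson open_contains_ball)
    \<comment> \<open>The closed ball must fit into \<open>U\<close> and have diameter below
      \<open>\<epsilon>\<close>, hence a radius below \<open>d\<close> and below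
      \<open>\<epsilon> / 2\<close>.\<close>
    define \<delta> where "\<delta> = min (d / 2) (\<epsilon> / 3)"
    have \<delta>: "0 < \<delta>" "\<delta> < d" "\<delta> < \<epsilon> / 2" using d(1) \<open>0 < \<epsilon>\<close> by (auto simp: \<delta>_def)
    obtain b where b: "b \<in> B" "z \<in> b" "b \<subseteq> ball z \<delta>"
      using B(2) \<delta>(1) by (metis centre_in_ball open_ball topological_basisE)
    have "b \<notin> N" using z(1) b(2) by blast
    then have "uncountable (\<pi> ` (E \<inter> b))" using b(1) by (auto simp: N_def)
    moreover have "\<pi> ` (E \<inter> b) \<subseteq> \<pi> ` (E \<inter> cball z \<delta>)" using b(3) by (auto simp: ball_def cball_def)
    ultimately have "uncountable (\<pi> ` (E \<inter> cball z \<delta>))" by (metis countable_subset)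
    moreover have "dist u v < \<epsilon>" if "u \<in> cball z \<delta>" "v \<in> cball z \<delta>" for u v
      using that \<delta>(3) dist_triangle3[of u v z] by auto
    moreover have "cball z \<delta> \<subseteq> U" using d(2) \<delta>(2) by (auto simp: subset_iff)
    ultimately show ?thesis using E(1) by (intro exI[of _ "E \<inter> cball z \<delta>"]) auto
  qed
  have "open {z. \<pi> z < c}" "open {z. c < \<pi> z}"
    using \<pi> by (auto intro!: open_Collect_less continuous_on_const)
  moreover have "\<pi> x < c" "c < \<pi> y" using xy(3) by (auto simp: c_def field_simps)
  ultimately obtain F G where
    "closed F \<and> F \<subseteq> E \<and> uncountable (\<pi> ` F) \<and> (\<forall>x\<in>F. \<forall>y\<in>F. dist x y < \<epsilon>) \<and> F \<subseteq> {z. \<pi> z < c}"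
    "closed G \<and> G \<subseteq> E \<and> uncountable (\<pi> ` G) \<and> (\<forall>x\<in>G. \<forall>y\<in>G. dist x y < \<epsilon>) \<and> G \<subseteq> {z. c < \<pi> z}"
    using piece[of x "{z. \<pi> z < c}"] piece[of y "{z. c < \<pi> z}"] xy(1,2) by auto
  then show ?thesis by (intro exI[of _ F] exI[of _ G] exI[of _ c]) auto
qed

lemma compact_UNIV_cantor: "compact (UNIV :: (nat \<Rightarrow> bool) set)"
proof -
  have "compact (UNIV :: bool set)" by (intro finite_imp_compact) simp
  then have "compact_space (product_topology (\<lambda>_::nat. euclidean :: bool topology) UNIV)"
    unfolding compact_space_product_topology by (auto simp: compact_space_def)
  then show ?thesis
    by (simp add: euclidean_product_topology compact_space_def)
qed

lemma open_cylinder: "open {b'. \<forall>i<n. b' i = b i}" for b :: "nat \<Rightarrow> bool"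
proof -
  have "open ((\<lambda>b'::nat \<Rightarrow> bool. b' i) -` {b i})" for i
    by (intro open_vimage continuous_on_coord open_discrete)
  then have "open (\<Inter>i\<in>{..<n}. (\<lambda>b'::nat \<Rightarrow> bool. b' i) -` {b i})" by (intro open_INT) auto
  also have "(\<Inter>i\<in>{..<n}. (\<lambda>b'::nat \<Rightarrow> bool. b' i) -` {b i}) = {b'. \<forall>i<n. b' i = b i}" by auto
  finally show ?thesis .
qed

text \<open>Splitting is iterated along the binary tree. Siblings are separated by their values and
  not merely disjoint, so the limit map is increasing for the lexicographic order; both injectivity
  and increasing maps from \<real> come from this.\<close>

lemma cantor_scheme:
  fixes \<pi> :: "'a::polish_space \<Rightarrow> real"
  assumes \<pi>: "continuous_on UNIV \<pi>" and C: "closed C" "uncountable (\<pi> ` C)"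
  obtains \<phi> :: "(nat \<Rightarrow> bool) \<Rightarrow> real" where "continuous_on UNIV \<phi>" "range \<phi> \<subseteq> \<pi> ` C"
    "\<And>b b' n. (\<And>i. i < n \<Longrightarrow> b i = b' i) \<Longrightarrow> \<not> b n \<Longrightarrow> b' n \<Longrightarrow> \<phi> b < \<phi> b'"
proof -
  define big where "big E \<longleftrightarrow> closed E \<and> uncountable (\<pi> ` E)" for E
  have "\<forall>n E. \<exists>F G. big E \<longrightarrow> big F \<and> big G \<and> F \<subseteq> E \<and> G \<subseteq> E \<and>
     (\<forall>x\<in>F. \<forall>y\<in>F. dist x y < 1 / Suc n) \<and> (\<forall>x\<in>G. \<forall>y\<in>G. dist x y < 1 / Suc n) \<and>
     (\<forall>x\<in>F. \<forall>y\<in>G. \<pi> x < \<pi> y)"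
  proof (intro allI)
    fix n :: nat and E
    show "\<exists>F G. big E \<longrightarrow> big F \<and> big G \<and> F \<subseteq> E \<and> G \<subseteq> E \<and>
     (\<forall>x\<in>F. \<forall>y\<in>F. dist x y < 1 / Suc n) \<and> (\<forall>x\<in>G. \<forall>y\<in>G. dist x y < 1 / Suc n) \<and>
     (\<forall>x\<in>F. \<forall>y\<in>G. \<pi> x < \<pi> y)"
    proof (cases "big E")
      case True
      then obtain F G c where "closed F \<and> closed G \<and> F \<subseteq> E \<and> G \<subseteq> E \<and> uncountable (\<pi> ` F) \<and> uncountable (\<pi> ` G) \<and>
         (\<forall>x\<in>F. \<forall>y\<in>F. dist x y < 1 / Suc n) \<and> (\<forall>x\<in>G. \<forall>y\<in>G. dist x y < 1 / Suc n) \<and>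
         (\<forall>x\<in>F. \<pi> x < c) \<and> (\<forall>x\<in>G. c < \<pi> x)"
        using uncountable_closed_split[OF \<pi>, of E "1 / Suc n"] by (auto simp: big_def)
      moreover from this have "\<pi> x < \<pi> y" if "x \<in> F" "y \<in> G" for x y
        using that by (meson less_trans)
      ultimately show ?thesis
        by (intro exI[of _ F] exI[of _ G]) (simp add: big_def)
    qed auto
  qed
  then obtain L R where LR: "\<And>n E. big E \<Longrightarrow> big (L n E) \<and> big (R n E) \<and> L n E \<subseteq> E \<and> R n E \<subseteq> E \<and>
     (\<forall>x\<in>L n E. \<forall>y\<in>L n E. dist x y < 1 / Suc n) \<and> (\<forall>x\<in>R n E. \<forall>y\<in>R n E. dist x y < 1 / Suc n) \<and>
     (\<forall>x\<in>L n E. \<forall>y\<in>R n E. \<pi> x < \<pi> y)"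
    unfolding choice_iff by blast
  \<comment> \<open>\<open>E b n\<close> depends only on the first \<open>n\<close> bits of
    \<open>b\<close>; continuity of the limit map rests on that.\<close>
  define E where "E = (\<lambda>b :: nat \<Rightarrow> bool. rec_nat C (\<lambda>n F. if b n then R n F else L n F))"
  have E0: "E b 0 = C" and ES: "E b (Suc n) = (if b n then R n (E b n) else L n (E b n))" for b n
    by (simp_all add: E_def)
  have big: "big (E b n)" for b n
    by (induction n) (use C LR in \<open>auto simp: E0 ES big_def\<close>)
  have sub: "E b (Suc n) \<subseteq> E b n" for b n
    using LR[OF big] by (auto simp: ES)
  have dec: "E b n \<subseteq> E b m" if "m \<le> n" for b m n
    using lift_Suc_antimono_le[of "E b", OF sub that] .
  \<comment> \<open>The shift matters: level 0 is \<open>C\<close> itself, whose diameter is not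
    controlled.\<close>
  have small: "dist x y < 1 / Suc n" if "x \<in> E b (Suc n)" "y \<in> E b (Suc n)" for b n x y
    using that LR[OF big, of n b n] by (auto simp: ES split: if_splits)
  have agree: "E b n = E b' n" if "\<And>i. i < n \<Longrightarrow> b i = b' i" for b b' n
    using that by (induction n) (auto simp: E0 ES)
  have "\<exists>z. \<forall>n. z \<in> E b n" for b
  proof (rule decreasing_closed_nest[of "E b"])
    show "closed (E b n)" "E b n \<noteq> {}" for n using big[of b n] by (auto simp: big_def)
    show "E b n \<subseteq> E b m" if "m \<le> n" for m n using dec that .
    show "\<exists>n. \<forall>x\<in>E b n. \<forall>y\<in>E b n. dist x y < \<epsilon>" if \<epsilon>: "0 < \<epsilon>" for \<epsilon>
    proof -
      obtain n where "1 / Suc n < \<epsilon>" using \<epsilon> nat_approx_posE by metis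
      then show ?thesis using small by (intro exI[of _ "Suc n"]) (meson less_trans)
    qed
  qed blast
  then obtain z where z: "\<And>b n. z b \<in> E b n" by metis
  have "continuous_on UNIV z"
    unfolding continuous_on_def tendsto_iff
  proof (intro ballI allI impI)
    fix b :: "nat \<Rightarrow> bool" and \<epsilon> :: real assume "0 < \<epsilon>"
    then obtain n where n: "1 / Suc n < \<epsilon>" using nat_approx_posE by metis
    have "dist (z b') (z b) < \<epsilon>" if "\<forall>i<Suc n. b' i = b i" for b'
    proof -
      have "E b' (Suc n) = E b (Suc n)" using that by (intro agree) auto
      then show ?thesis using small[of "z b'" b n "z b"] z n by (metis less_trans)
    qed
    then show "\<forall>\<^sub>F b' in at b. dist (z b') (z b) < \<epsilon>"
      unfolding eventually_at_topological
      using open_cylinder[of "Suc n" b] by (intro exI[of _ "{b'. \<forall>i<Suc n. b' i = b i}"]) simp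
  qed
  show ?thesis
  proof (rule that[of "\<lambda>b. \<pi> (z b)"])
    show "continuous_on UNIV (\<lambda>b. \<pi> (z b))"
      using continuous_on_compose2[OF \<pi> \<open>continuous_on UNIV z\<close>] by simp
    show "range (\<lambda>b. \<pi> (z b)) \<subseteq> \<pi> ` C" using z[of _ 0] by (auto simp: E0)
    fix b b' :: "nat \<Rightarrow> bool" and n assume "\<And>i. i < n \<Longrightarrow> b i = b' i" "\<not> b n" "b' n"
    then have "z b \<in> L n (E b n)" "z b' \<in> R n (E b n)"
      using z[of b "Suc n"] z[of b' "Suc n"] agree[of n b b'] by (auto simp: ES)
    then show "\<pi> (z b) < \<pi> (z b')" using LR[OF big, of n b n] by blast
  qed
qed

text \<open>The Cantor scheme is run on a closed set projecting onto \<open>A\<close>. The image of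
  Cantor space is perfect, and composing with an increasing coding of reals by bit sequences shows
  that \<open>A\<close> is fat.\<close>

theorem uncountable_borel_perfect_fat:
  assumes A: "A \<in> sets (borel :: real measure)" "uncountable A"
  shows "(\<exists>Q. perfect Q \<and> Q \<subseteq> A) \<and> fat A"
proof -
  obtain C where "projects_onto C A" using projects_onto_borel[OF A(1)] by blast
  then have C: "closed C" "(\<lambda>s. s 0) ` C = A" by (simp_all add: projects_onto_def)
  obtain \<phi> :: "(nat \<Rightarrow> bool) \<Rightarrow> real" where \<phi>: "continuous_on UNIV \<phi>" "range \<phi> \<subseteq> A"
    and lex: "\<And>b b' n. (\<And>i. i < n \<Longrightarrow> b i = b' i) \<Longrightarrow> \<not> b n \<Longrightarrow> b' n \<Longrightarrow> \<phi> b < \<phi> b'"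
    by (rule cantor_scheme[of "\<lambda>s::nat \<Rightarrow> real. s 0" C, OF continuous_on_coord C(1)])
      (use A(2) C(2) in auto)
  have inj: "\<phi> b \<noteq> \<phi> b'" if "b \<noteq> b'" for b b'
  proof -
    define n where "n = (LEAST n. b n \<noteq> b' n)"
    have "\<exists>n. b n \<noteq> b' n" using that by blast
    then have n: "b n \<noteq> b' n" unfolding n_def by (rule LeastI_ex)
    have below: "b i = b' i" if "i < n" for i
      using not_less_Least[of i "\<lambda>n. b n \<noteq> b' n"] that by (simp add: n_def)
    show ?thesis
    proof (cases "b n")
      case True
      then have "\<phi> b' < \<phi> b" using n by (intro lex[of n]) (simp_all add: below)
      then show ?thesis by simp
    next
      case False
      then have "\<phi> b < \<phi> b'" using n by (intro lex[of n]) (simp_all add: below)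
      then show ?thesis by simp
    qed
  qed
  have "perfect (range \<phi>)"
    unfolding perfect_def
  proof (intro conjI ballI)
    show "closed (range \<phi>)"
      using compact_continuous_image[OF \<phi>(1) compact_UNIV_cantor] by (rule compact_imp_closed)
    fix x assume "x \<in> range \<phi>"
    then obtain b where b: "x = \<phi> b" by auto
    show "x islimpt range \<phi>"
      unfolding islimpt_def
    proof (intro allI impI)
      fix T assume T: "x \<in> T" "open T"
      \<comment> \<open>Flipping the \<open>n\<close>-th bit of \<open>b\<close> gives points
        different from \<open>b\<close> that converge to it, so \<open>x\<close> is not
        isolated.\<close>
      have "(\<lambda>n. (b(n := \<not> b n)) i) \<longlonglongrightarrow> b i" for i
        by (intro tendsto_eventually eventually_sequentiallyI[of "Suc i"]) auto
      then have "limitin (product_topology (\<lambda>_. euclidean) UNIV) (\<lambda>n. b(n := \<not> b n)) b sequentially"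
        unfolding limitin_componentwise by simp
      then have "(\<lambda>n. b(n := \<not> b n)) \<longlonglongrightarrow> b"
        by (simp add: euclidean_product_topology)
      then have "(\<lambda>n. \<phi> (b(n := \<not> b n))) \<longlonglongrightarrow> \<phi> b"
        by (rule continuous_on_tendsto_compose[OF \<phi>(1)]) auto
      then have "\<forall>\<^sub>F n in sequentially. \<phi> (b(n := \<not> b n)) \<in> T"
        using T b by (intro topological_tendstoD) auto
      then obtain n where "\<phi> (b(n := \<not> b n)) \<in> T"
        using eventually_happens'[OF sequentially_bot] by blast
      moreover have "b(n := \<not> b n) \<noteq> b" by (metis fun_upd_same)
      ultimately show "\<exists>y\<in>range \<phi>. y \<in> T \<and> y \<noteq> x" using inj b by blast
    qed
  qed auto
  moreover have "fat A"
    unfolding fat_def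
  proof (intro exI conjI)
    \<comment> \<open>A real is coded by its lower cut along an enumeration of the rationals. For
      \<open>x < y\<close> the first rational on which the cuts differ is missing from the cut of
      \<open>x\<close> only, so the coding is lexicographically increasing.\<close>
    let ?e = "\<lambda>x::real. \<phi> (\<lambda>n. real_of_rat (from_nat n) < x)"
    show "strict_mono ?e"
    proof (rule strict_monoI)
      fix x y :: real assume xy: "x < y"
      define P where "P n \<longleftrightarrow> \<not> real_of_rat (from_nat n) < x \<and> real_of_rat (from_nat n) < y" for n
      obtain q where "x < real_of_rat q" "real_of_rat q < y" using of_rat_dense[OF xy] by auto
      then have "P (to_nat q)" by (simp add: P_def)
      then have P: "P (Least P)" "\<And>i. i < Least P \<Longrightarrow> \<not> P i"
        by (rule LeastI) (rule not_less_Least)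
      have "(real_of_rat (from_nat i) < x) = (real_of_rat (from_nat i) < y)" if "i < Least P" for i
        using P(2)[OF that] xy unfolding P_def by linarith
      then show "?e x < ?e y" using P(1) by (intro lex[of "Least P"]) (auto simp: P_def)
    qed
    show "range ?e \<subseteq> A" using \<phi>(2) by auto
  qed
  ultimately show ?thesis using \<phi>(2) by blast
qed

section \<open>Perfect sets versus fat sets\<close>

lemma perfect_uncountable:
  assumes "perfect P"
  shows "uncountable P"
proof -
  have "euclidean derived_set_of P = P"
  proof -
    have "x \<in> euclidean derived_set_of P \<longleftrightarrow> x islimpt P" for x
      unfolding derived_set_of_def islimpt_def by auto
    then show ?thesis using assms unfolding perfect_def closed_limpt by blast
  qed
  then have "(UNIV :: real set) \<lesssim> P"
    using assms by (intro lepoll_perfect_set[of euclidean]) (auto simp: perfect_def completely_metrizable_space_euclidean)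
  then show ?thesis
    using countable_lepoll[of P "UNIV :: real set"] uncountable_UNIV_real by blast
qed

lemma perfect_fat:
  assumes "perfect P"
  shows "fat P"
proof -
  have "P \<in> sets borel" using assms by (simp add: perfect_def)
  then show ?thesis using perfect_uncountable[OF assms] uncountable_borel_perfect_fat by blast
qed

text \<open>To apply the perfect set theorem, the image of the unit interval must be Borel. It is
  the fixed point set of \<open>e \<circ> g\<close>, where \<open>g\<close> is a monotone left
  inverse of \<open>e\<close>; both maps are monotone and hence Borel.\<close>

lemma fat_contains_perfect:
  assumes "fat A"
  obtains Q where "perfect Q" "Q \<subseteq> A"
proof -
  obtain e :: "real \<Rightarrow> real" where e: "strict_mono e" "range e \<subseteq> A"
    using assms unfolding fat_def by metis
  \<comment> \<open>Inserting 0 keeps the set nonempty for every \<open>y\<close>, so its supremum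
    always lies in the unit interval.\<close>
  define I where "I y = insert 0 {x \<in> {0..1}. e x \<le> y}" for y
  define g where "g y = Sup (I y)" for y
  have I: "I y \<noteq> {}" "bdd_above (I y)" "I y \<subseteq> {0..1}" for y
    by (auto simp: I_def intro!: bdd_aboveI[of _ 1])
  have "mono g"
  proof (rule monoI)
    fix x y :: real assume "x \<le> y"
    then show "g x \<le> g y" unfolding g_def using I by (intro cSup_subset_mono) (auto simp: I_def)
  qed
  then have meas: "(\<lambda>y. e (g y)) \<in> borel_measurable borel"
    using measurable_compose[OF borel_measurable_mono borel_measurable_mono] strict_mono_mono[OF e(1)]
    by blast
  have g01: "g y \<in> {0..1}" for y
  proof -
    have "0 \<le> g y" unfolding g_def using I by (intro cSup_upper) (auto simp: I_def)
    moreover have "g y \<le> 1" unfolding g_def using I by (intro cSup_least) (auto simp: I_def)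
    ultimately show ?thesis by simp
  qed
  have ge: "g (e x) = x" if "x \<in> {0..1}" for x
  proof -
    have "I (e x) = {0..x}"
      using that strict_mono_less_eq[OF e(1)] by (auto simp: I_def)
    then show ?thesis using that by (simp add: g_def)
  qed
  have "{y. e (g y) = y} = e ` {0..1}"
  proof (intro equalityI subsetI)
    show "y \<in> e ` {0..1}" if "y \<in> {y. e (g y) = y}" for y
      using that g01[of y] by (intro image_eqI[of _ _ "g y"]) auto
    show "y \<in> {y. e (g y) = y}" if "y \<in> e ` {0..1}" for y
      using that ge by auto
  qed
  moreover have "{y. e (g y) = y} \<in> sets borel"
    using meas by measurable
  ultimately have "e ` {0..1} \<in> sets borel" by simp
  moreover have "uncountable (e ` {0..1})"
  proof
    assume "countable (e ` {0..1})"
    then have "countable {0..1::real}"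
      by (rule countable_image_inj_on) (rule inj_on_subset[OF strict_mono_on_imp_inj_on[OF e(1)]], simp)
    then show False using uncountable_closed_interval[of 0 "1::real"] by simp
  qed
  ultimately obtain Q where "perfect Q" "Q \<subseteq> e ` {0..1}"
    using uncountable_borel_perfect_fat by blast
  then show ?thesis using that e(2) by blast
qed

section \<open>Sacks forcing, Borel sets and fat sets\<close>

lemma preord_sacks: "preord sacks"
  by (simp add: sacks_def preord_relation_of_subset)

lemma dense_embedding_sacks_fat:
  "dense_embedding sacks (relation_of (\<subseteq>) {A. fat A}) (\<lambda>Q. Q)"
  unfolding sacks_def
proof (rule dense_embedding_family)
  show "Q \<in> {A. fat A}" if "Q \<in> {P. perfect P}" for Q
    using that perfect_fat by simp
  have perf: "\<exists>Q\<in>{P. perfect P}. Q \<subseteq> A" if "A \<in> {A. fat A}" for A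
    using that by (auto elim: fat_contains_perfect)
  then show "\<exists>Q\<in>{P. perfect P}. Q \<subseteq> A" if "A \<in> {A. fat A}" for A
    using that .
  show "\<exists>C\<in>{P. perfect P}. C \<subseteq> Q \<and> C \<subseteq> Q'" if "B \<in> {A. fat A}" "B \<subseteq> Q" "B \<subseteq> Q'" for B Q Q'
    using perf[OF that(1)] that(2,3) by (meson order_trans)
qed

section \<open>Borel sets modulo countable sets\<close>

abbreviation borel_class :: "real set \<Rightarrow> real set set" where
  "borel_class A \<equiv> eq_mod_countable `` {A}"

lemma eq_mod_countable_iff:
  "(A, B) \<in> eq_mod_countable \<longleftrightarrow>
     A \<in> sets borel \<and> B \<in> sets borel \<and> countable (A - B) \<and> countable (B - A)"
  by (auto simp: eq_mod_countable_def)

lemma countable_Diff_trans: "countable (A - B) \<Longrightarrow> countable (B - C) \<Longrightarrow> countable (A - C)"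
  by (rule countable_subset[of _ "(A - B) \<union> (B - C)"]) auto

lemma equiv_eq_mod_countable: "equiv (sets borel) eq_mod_countable"
proof (rule equivI)
  show "eq_mod_countable \<subseteq> sets borel \<times> sets borel" by (auto simp: eq_mod_countable_iff)
  show "refl_on (sets borel) eq_mod_countable" by (auto simp: refl_on_def eq_mod_countable_iff)
  show "sym eq_mod_countable" by (auto simp: sym_def eq_mod_countable_iff)
  show "trans eq_mod_countable"
  proof (rule transI)
    fix A B C assume "(A, B) \<in> eq_mod_countable" "(B, C) \<in> eq_mod_countable"
    then show "(A, C) \<in> eq_mod_countable"
      unfolding eq_mod_countable_iff
      using countable_Diff_trans[of A B C] countable_Diff_trans[of C B A] by simp
  qed
qed

lemma borel_class_eq_iff:
  assumes "A \<in> sets borel" "B \<in> sets borel"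
  shows "borel_class A = borel_class B \<longleftrightarrow> countable (A - B) \<and> countable (B - A)"
  using eq_equiv_class_iff[OF equiv_eq_mod_countable assms] assms by (simp add: eq_mod_countable_iff)

lemma bmeet_borel_class:
  assumes "A \<in> sets borel" "B \<in> sets borel"
  shows "bmeet borel_mod_countable (borel_class A) (borel_class B) = borel_class (A \<inter> B)"
proof -
  have eq: "borel_class (A' \<inter> B') = borel_class (A \<inter> B)"
    if "A' \<in> borel_class A" "B' \<in> borel_class B" for A' B'
  proof -
    have *: "A' \<in> sets borel" "B' \<in> sets borel" "countable (A - A')" "countable (A' - A)"
      "countable (B - B')" "countable (B' - B)"
      using that by (simp_all add: eq_mod_countable_iff)
    have "countable (A' \<inter> B' - A \<inter> B)"
      by (rule countable_subset[of _ "(A' - A) \<union> (B' - B)"]) (use * in auto)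
    moreover have "countable (A \<inter> B - A' \<inter> B')"
      by (rule countable_subset[of _ "(A - A') \<union> (B - B')"]) (use * in auto)
    ultimately show ?thesis using * assms by (simp add: borel_class_eq_iff)
  qed
  have ne: "A \<in> borel_class A" "B \<in> borel_class B"
    using assms by (simp_all add: eq_mod_countable_iff)
  have "bmeet borel_mod_countable (borel_class A) (borel_class B)
      = (\<Union>A'\<in>borel_class A. \<Union>B'\<in>borel_class B. borel_class (A \<inter> B))"
    unfolding borel_mod_countable_def using eq by (simp cong: SUP_cong_simp)
  also have "\<dots> = borel_class (A \<inter> B)"
    using ne by auto
  finally show ?thesis .
qed

abbreviation borel_poset :: "real set set rel" where
  "borel_poset \<equiv> positive_poset borel_mod_countable"

lemma borel_poset_iff:
  assumes "A \<in> sets borel" "B \<in> sets borel"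
  shows "(borel_class A, borel_class B) \<in> borel_poset \<longleftrightarrow>
    uncountable A \<and> uncountable B \<and> countable (A - B)"
proof -
  have ne: "borel_class A \<noteq> bzero borel_mod_countable \<longleftrightarrow> uncountable A" if "A \<in> sets borel" for A
    using that by (simp add: borel_mod_countable_def borel_class_eq_iff)
  have el: "borel_class A \<in> elems borel_mod_countable" if "A \<in> sets borel" for A
    using that by (simp add: borel_mod_countable_def quotientI)
  have "borel_class (A \<inter> B) = borel_class A \<longleftrightarrow> countable (A - B)"
  proof -
    have "countable (A \<inter> B - A)" by (rule countable_subset[of _ "{}"]) auto
    moreover have "A - A \<inter> B = A - B" by auto
    ultimately show ?thesis using assms by (simp add: borel_class_eq_iff)
  qed
  then show ?thesis
    unfolding positive_poset_def relation_of_def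
    using ne el assms by (auto simp: bmeet_borel_class)
qed

lemma Field_borel_poset_cases:
  assumes "a \<in> Field borel_poset"
  obtains A where "a = borel_class A" "A \<in> sets borel" "uncountable A"
proof -
  have a: "a \<in> sets borel // eq_mod_countable" "a \<noteq> borel_class {}"
    using assms unfolding positive_poset_def relation_of_def Field_def
    by (auto simp: borel_mod_countable_def)
  from a(1) obtain A where A: "a = borel_class A" "A \<in> sets borel" by (rule quotientE)
  with a(2) have "uncountable A" by (simp add: borel_class_eq_iff)
  with A that show ?thesis by blast
qed

lemma preord_borel_poset: "preord borel_poset"
  unfolding preord_def
proof (intro conjI ballI transI)
  show "(a, a) \<in> borel_poset" if "a \<in> Field borel_poset" for a
    using that by (elim Field_borel_poset_cases) (simp add: borel_poset_iff)
  fix a b c assume ab: "(a, b) \<in> borel_poset" and bc: "(b, c) \<in> borel_poset"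
  obtain A where A: "a = borel_class A" "A \<in> sets borel" "uncountable A"
    using FieldI1[OF ab] by (rule Field_borel_poset_cases)
  obtain B where B: "b = borel_class B" "B \<in> sets borel" "uncountable B"
    using FieldI1[OF bc] by (rule Field_borel_poset_cases)
  obtain C where C: "c = borel_class C" "C \<in> sets borel" "uncountable C"
    using FieldI2[OF bc] by (rule Field_borel_poset_cases)
  show "(a, c) \<in> borel_poset"
    using ab bc countable_Diff_trans[of A B C] A B C by (simp add: borel_poset_iff)
qed

text \<open>Compatibility is reflected because an uncountable Borel set almost contained in
  \<open>P\<close> and in \<open>Q\<close> makes \<open>P \<inter> Q\<close> uncountable; this
  intersection is Borel and contains a perfect set.\<close>

lemma dense_embedding_sacks_borel: "dense_embedding sacks borel_poset borel_class"
proof -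
  have F: "Field sacks = {P. perfect P}" by (simp add: sacks_def)
  have bor: "P \<in> sets borel" if "perfect P" for P
    using that by (simp add: perfect_def)
  show ?thesis
    unfolding dense_embedding_def F
  proof (intro conjI allI impI ballI)
    fix P Q assume "(P, Q) \<in> sacks"
    then have "perfect P" "perfect Q" "P \<subseteq> Q" by (auto simp: sacks_def relation_of_def)
    moreover from \<open>P \<subseteq> Q\<close> have "countable (P - Q)" by (simp add: Diff_eq_empty_iff[THEN iffD2])
    ultimately show "(borel_class P, borel_class Q) \<in> borel_poset"
      by (simp add: borel_poset_iff bor perfect_uncountable)
  next
    fix P Q assume P: "P \<in> {P. perfect P}" and Q: "Q \<in> {P. perfect P}"
      and "compatible borel_poset (borel_class P) (borel_class Q)"
    then obtain a where a: "(a, borel_class P) \<in> borel_poset" "(a, borel_class Q) \<in> borel_poset"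
      unfolding compatible_def by metis
    obtain A where A: "a = borel_class A" "A \<in> sets borel" "uncountable A"
      using FieldI1[OF a(1)] by (rule Field_borel_poset_cases)
    have c: "countable (A - P)" "countable (A - Q)"
      using a A P Q by (simp_all add: borel_poset_iff bor)
    have "A - (A - P) - (A - Q) \<subseteq> P \<inter> Q" by blast
    moreover have "uncountable (A - (A - P) - (A - Q))"
      using A(3) c by (simp add: uncountable_minus_countable)
    ultimately have "uncountable (P \<inter> Q)" by (metis countable_subset)
    moreover have "P \<inter> Q \<in> sets borel" using P Q bor by auto
    ultimately obtain R where R: "perfect R" "R \<subseteq> P \<inter> Q"
      using uncountable_borel_perfect_fat by metis
    then have "(R, P) \<in> sacks" "(R, Q) \<in> sacks" using P Q by (auto simp: sacks_def relation_of_def)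
    then show "compatible sacks P Q" unfolding compatible_def by metis
  next
    fix a assume "a \<in> Field borel_poset"
    then obtain A where A: "a = borel_class A" "A \<in> sets borel" "uncountable A"
      by (rule Field_borel_poset_cases)
    then obtain R where R: "perfect R" "R \<subseteq> A"
      using uncountable_borel_perfect_fat by metis
    then have "countable (R - A)" by (simp add: Diff_eq_empty_iff[THEN iffD2])
    then have "(borel_class R, a) \<in> borel_poset"
      using A R by (simp add: borel_poset_iff bor perfect_uncountable)
    then show "\<exists>P\<in>{P. perfect P}. (borel_class P, a) \<in> borel_poset"
      using R(1) by blast
  qed
qed

section \<open>Fat subsets of a fat set\<close>

lemma fat_mono: "fat A \<Longrightarrow> A \<subseteq> B \<Longrightarrow> fat B"
  unfolding fat_def by (metis order_trans)

lemma fat_image: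
  assumes "fat A" "strict_mono_on A f"
  shows "fat (f ` A)"
proof -
  obtain e :: "real \<Rightarrow> real" where e: "strict_mono e" "range e \<subseteq> A"
    using assms(1) unfolding fat_def by metis
  have "strict_mono (\<lambda>x. f (e x))"
  proof (rule strict_monoI)
    fix x y :: real assume "x < y"
    then have "e x < e y" using e(1) by (rule strict_monoD[rotated])
    moreover have "e x \<in> A" "e y \<in> A" using e(2) by auto
    ultimately show "f (e x) < f (e y)" using strict_mono_onD[OF assms(2)] by simp
  qed
  moreover have "range (\<lambda>x. f (e x)) \<subseteq> f ` A" using e(2) by auto
  ultimately show ?thesis unfolding fat_def by metis
qed

lemma fat_image_iff:
  fixes e :: "real \<Rightarrow> real"
  assumes e: "strict_mono e"
  shows "fat (e ` A) \<longleftrightarrow> fat A"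
proof
  assume "fat A"
  then show "fat (e ` A)" by (rule fat_image) (use e in \<open>auto simp: strict_mono_on_def\<close>)
next
  assume "fat (e ` A)"
  then have "fat (inv e ` e ` A)"
  proof (rule fat_image)
    show "strict_mono_on (e ` A) (inv e)"
      using strict_mono_less[OF e] strict_mono_imp_inj_on[OF e]
      by (auto simp: strict_mono_on_def inv_f_f)
  qed
  moreover have "inv e ` e ` A = A"
    using strict_mono_imp_inj_on[OF e] by (simp add: image_image)
  ultimately show "fat A" by simp
qed

abbreviation fat_poset :: "real set \<Rightarrow> real set rel" where
  "fat_poset S \<equiv> relation_of (\<subseteq>) {A. A \<subseteq> S \<and> fat A}"

text \<open>A strictly increasing \<open>e\<close> maps \<open>\<real>\<close> into \<open>S\<close>. As \<open>S\<close> need not be measurable, the classical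
  piecewise bijection of Cantor and Bernstein between \<open>\<real>\<close> and \<open>S\<close> does not preserve fat sets; the
  pieces are taken instead to be the downward closed family \<open>W\<close> of fat sets and its pseudocomplement
  \<open>W'\<close>.\<close>

lemma ba_isomorphic_fat_poset:
  assumes "fat S"
  shows "ba_isomorphic (ro (fat_poset S)) (ro (relation_of (\<subseteq>) {A. fat A}))"
proof -
  obtain e :: "real \<Rightarrow> real" where e: "strict_mono e" "range e \<subseteq> S"
    using assms unfolding fat_def by metis
  have inje: "inj e" using strict_mono_imp_inj_on[OF e(1)] .
  \<comment> \<open>\<open>W\<close> imitates the iterated images under \<open>e\<close> of the
    complement of \<open>S\<close>, the set on which the classical bijection applies
    \<open>e\<close>. "Disjoint from \<open>S\<close>" is weakened to "without fat part in
    \<open>S\<close>".\<close>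
  define W where "W = {A. fat A \<and> (\<exists>n B. A = (e ^^ n) ` B \<and> \<not> fat (B \<inter> S))}"
  define W' where "W' = {A. fat A \<and> (\<forall>B. B \<subseteq> A \<longrightarrow> B \<notin> W)}"
  \<comment> \<open>Members of \<open>W'\<close> are left fixed and need not be subsets of
    \<open>S\<close>; \<open>T\<close> is the wider target in which the fat subsets of
    \<open>S\<close> are dense.\<close>
  define T where "T = {A. fat A \<and> (\<forall>B. B \<subseteq> A \<longrightarrow> fat B \<longrightarrow> fat (B \<inter> S))}"
  define h where "h A = (if A \<in> W then e ` A else A)" for A
  have W_I: "(e ^^ n) ` B \<in> W" if "fat ((e ^^ n) ` B)" "\<not> fat (B \<inter> S)" for n B
    using that unfolding W_def by (intro CollectI conjI exI[of _ n] exI[of _ B]) simp_all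
  have W_E: "\<exists>n B. A = (e ^^ n) ` B \<and> \<not> fat (B \<inter> S)" "fat A" if "A \<in> W" for A
    using that unfolding W_def by simp_all
  have W'_D: "B \<notin> W" if "A \<in> W'" "B \<subseteq> A" for A B
    using that unfolding W'_def by simp
  have W_down: "B \<in> W" if A: "A \<in> W" and B: "B \<subseteq> A" "fat B" for A B
  proof -
    obtain n C where C: "A = (e ^^ n) ` C" "\<not> fat (C \<inter> S)" using W_E(1)[OF A] by blast
    obtain D where D: "D \<subseteq> C" "B = (e ^^ n) ` D" using B(1) C(1) by (meson subset_imageE)
    have "\<not> fat (D \<inter> S)" using C(2) D(1) fat_mono[of "D \<inter> S" "C \<inter> S"] by blast
    then show ?thesis using B(2) D(2) W_I by simp
  qed
  have eW: "e ` A \<in> W" if A: "A \<in> W" for A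
  proof -
    obtain n C where C: "A = (e ^^ n) ` C" "\<not> fat (C \<inter> S)" using W_E(1)[OF A] by blast
    have "e ` A = (e ^^ Suc n) ` C" using C(1) by (simp add: image_image)
    moreover have "fat (e ` A)" using W_E(2)[OF A] by (simp add: fat_image_iff[OF e(1)])
    ultimately show ?thesis using W_I[of "Suc n" C] C(2) by simp
  qed
  have subS: "A \<in> T" if "fat A" "A \<subseteq> S" for A
  proof -
    have "fat (B \<inter> S)" if "B \<subseteq> A" "fat B" for B
    proof -
      have "B \<inter> S = B" using \<open>B \<subseteq> A\<close> \<open>A \<subseteq> S\<close> by auto
      then show ?thesis using \<open>fat B\<close> by simp
    qed
    then show ?thesis using \<open>fat A\<close> by (simp add: T_def)
  qed
  have dens: "\<exists>B\<in>W \<union> W'. B \<subseteq> A" if A: "fat A" for A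
  proof (cases "A \<in> W'")
    case False
    then obtain B where "B \<subseteq> A" "B \<in> W" using A by (auto simp: W'_def)
    then show ?thesis by blast
  qed blast
  have fatW: "fat A" if "A \<in> W \<union> W'" for A
    using that W_E(2) unfolding W'_def by blast
  have W_Int: "\<exists>C\<in>W \<union> W'. C \<subseteq> A \<and> C \<subseteq> A'" if "fat B" "B \<subseteq> A" "B \<subseteq> A'" for A A' B
  proof -
    obtain C where "C \<in> W \<union> W'" "C \<subseteq> B" using dens[OF \<open>fat B\<close>] by blast
    then show ?thesis using that(2,3) by (intro bexI[of _ C]) auto
  qed
  have 1: "dense_embedding (relation_of (\<subseteq>) (W \<union> W')) (relation_of (\<subseteq>) {A. fat A}) (\<lambda>A. A)"
  proof (rule dense_embedding_family)
    show "A \<in> {A. fat A}" if "A \<in> W \<union> W'" for A using fatW[OF that] by simp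
    show "\<exists>C\<in>W \<union> W'. C \<subseteq> A \<and> C \<subseteq> A'" if "B \<in> {A. fat A}" "B \<subseteq> A" "B \<subseteq> A'" for A A' B
      using W_Int[OF _ that(2,3)] that(1) by simp
    show "\<exists>A\<in>W \<union> W'. A \<subseteq> B" if "B \<in> {A. fat A}" for B
      using dens that by simp
  qed
  have 2: "dense_embedding (fat_poset S) (relation_of (\<subseteq>) T) (\<lambda>A. A)"
  proof (rule dense_embedding_family)
    show "A \<in> T" if "A \<in> {A. A \<subseteq> S \<and> fat A}" for A using that subS by simp
    show "\<exists>C\<in>{A. A \<subseteq> S \<and> fat A}. C \<subseteq> A \<and> C \<subseteq> A'"
      if "A \<in> {A. A \<subseteq> S \<and> fat A}" "B \<in> T" "B \<subseteq> A" "B \<subseteq> A'" for A A' B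
      using that by (intro bexI[of _ B]) (auto simp: T_def)
    show "\<exists>A\<in>{A. A \<subseteq> S \<and> fat A}. A \<subseteq> B" if "B \<in> T" for B
      using that by (intro bexI[of _ "B \<inter> S"]) (auto simp: T_def)
  qed
  have 3: "dense_embedding (relation_of (\<subseteq>) (W \<union> W')) (relation_of (\<subseteq>) T) h"
  proof (rule dense_embedding_family)
    fix A assume A: "A \<in> W \<union> W'"
    show "h A \<in> T"
    proof (cases "A \<in> W")
      case True
      have "fat (e ` A)" using fatW[OF A] by (simp add: fat_image_iff[OF e(1)])
      moreover have "e ` A \<subseteq> S" using e(2) by auto
      ultimately have "e ` A \<in> T" by (rule subS)
      then show ?thesis using True by (simp add: h_def)
    next
      case False
      have "fat (B \<inter> S)" if "B \<subseteq> A" "fat B" for B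
      proof (rule ccontr)
        assume "\<not> fat (B \<inter> S)"
        then have "B \<in> W" using W_I[of 0 B] \<open>fat B\<close> by simp
        then show False using A False W'_D[of A B] \<open>B \<subseteq> A\<close> by simp
      qed
      then show ?thesis using fatW[OF A] False by (simp add: h_def T_def)
    qed
    fix A' assume A': "A' \<in> W \<union> W'"
    show "h A \<subseteq> h A'" if "A \<subseteq> A'"
    proof (cases "A \<in> W")
      case True
      then have "A' \<in> W" using A' W'_D[of A' A] that by auto
      then show ?thesis using True that by (auto simp: h_def)
    next
      case False
      then have "A' \<notin> W" using W_down[OF _ that fatW[OF A]] by auto
      then show ?thesis using False that by (simp add: h_def)
    qed
    \<comment> \<open>The two pieces cannot meet after the shift: \<open>e\<close> maps
      \<open>W\<close> into \<open>W\<close>, and no member of \<open>W'\<close> has a subset in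
      \<open>W\<close>.\<close>
    have mixed: False if "C \<in> W" "C' \<in> W'" "fat B" "B \<subseteq> e ` C" "B \<subseteq> C'" for C C' B
    proof -
      have "B \<in> W" using W_down[OF eW[OF that(1)] that(4,3)] .
      then show False using W'_D[OF that(2,5)] by simp
    qed
    fix B assume B: "B \<in> T" "B \<subseteq> h A" "B \<subseteq> h A'"
    then have fB: "fat B" by (simp add: T_def)
    show "\<exists>C\<in>W \<union> W'. C \<subseteq> A \<and> C \<subseteq> A'"
    proof (cases "A \<in> W"; cases "A' \<in> W")
      assume "A \<in> W" "A' \<in> W"
      then have "B \<subseteq> e ` A \<inter> e ` A'" using B by (simp add: h_def)
      then have "B \<subseteq> e ` (A \<inter> A')" using image_Int[OF inje] by metis
      then have "fat (e ` (A \<inter> A'))" using fB fat_mono by metis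
      then have "fat (A \<inter> A')" using e(1) by (simp add: fat_image_iff)
      then show ?thesis using W_Int[of "A \<inter> A'" A A'] by simp
    next
      assume "A \<notin> W" "A' \<notin> W"
      then show ?thesis using W_Int[OF fB] B by (simp add: h_def)
    next
      assume "A \<in> W" "A' \<notin> W"
      then show ?thesis using mixed[of A A' B] A' fB B by (simp add: h_def)
    next
      assume "A \<notin> W" "A' \<in> W"
      then show ?thesis using mixed[of A' A B] A fB B by (simp add: h_def)
    qed
  next
    fix B assume B: "B \<in> T"
    then have fB: "fat B" by (simp add: T_def)
    show "\<exists>A\<in>W \<union> W'. h A \<subseteq> B"
    proof (cases "B \<in> W'")
      case True
      then show ?thesis using W'_D[OF True] by (intro bexI[of _ B]) (auto simp: h_def)
    next
      case False
      then obtain C where C: "C \<subseteq> B" "C \<in> W" using fB by (auto simp: W'_def)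
      obtain n D where D: "C = (e ^^ n) ` D" "\<not> fat (D \<inter> S)" using W_E(1)[OF C(2)] by blast
      have fC: "fat C" using W_E(2)[OF C(2)] .
      \<comment> \<open>With \<open>n = 0\<close> the fat set \<open>C\<close> would have no fat
        part in \<open>S\<close>, against \<open>B \<in> T\<close>. So one application of
        \<open>e\<close> can be peeled off, which is surjectivity onto the \<open>W\<close>
        part.\<close>
      have "n \<noteq> 0"
      proof
        assume "n = 0"
        then have "\<not> fat (C \<inter> S)" using D by simp
        then show False using B C(1) fC by (simp add: T_def)
      qed
      then obtain m where m: "n = Suc m" by (cases n) auto
      define A where "A = (e ^^ m) ` D"
      have CA: "C = e ` A" using D(1) m by (simp add: A_def image_image)
      have "fat A" using fC CA fat_image_iff[OF e(1)] by simp
      then have "A \<in> W" unfolding A_def using D(2) by (intro W_I)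
      then show ?thesis using CA C(1) by (intro bexI[of _ A]) (simp_all add: h_def)
    qed
  qed
  note pre = preord_relation_of_subset
  \<comment> \<open>The path leads from \<open>fat_poset S\<close> through \<open>T\<close> and
    \<open>W \<union> W'\<close> to all fat sets.\<close>
  show ?thesis
    using ba_isomorphic_trans[OF ba_isomorphic_ro_sym[OF pre ba_isomorphic_dense_embedding[OF pre pre 2]]
        ba_isomorphic_trans[OF ba_isomorphic_dense_embedding[OF pre pre 3]
          ba_isomorphic_ro_sym[OF pre ba_isomorphic_dense_embedding[OF pre pre 1]]]] .
qed

section \<open>Order patterns of discontinuous functions\<close>

definition straddles :: "(real \<Rightarrow> real) \<Rightarrow> real \<Rightarrow> real \<Rightarrow> bool" where
  "straddles h p x \<longleftrightarrow> (\<forall>T. open T \<longrightarrow> x \<in> T \<longrightarrow> (\<exists>u\<in>T. \<exists>v\<in>T. h u < p \<and> p < h v))"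

text \<open>At a discontinuity values jump away from \<open>h x\<close> by at least some
  \<open>\<epsilon>\<close> in every neighbourhood. If upward jumps are missing in one neighbourhood
  and downward ones in another, the intersection has neither; so a rational just above or just below
  \<open>h x\<close> is straddled.\<close>

lemma straddles_if_not_isCont:
  assumes "\<not> isCont h x"
  obtains p where "p \<in> \<rat>" "straddles h p x"
proof -
  obtain \<epsilon> where \<epsilon>: "0 < \<epsilon>" and far: "\<And>\<delta>. 0 < \<delta> \<Longrightarrow> \<exists>y. dist y x < \<delta> \<and> \<epsilon> \<le> dist (h y) (h x)"
    using assms unfolding continuous_at_eps_delta by (metis not_less)
  obtain p where p: "p \<in> \<rat>" "h x < p" "p < h x + \<epsilon>" using Rats_dense_in_real[of "h x" "h x + \<epsilon>"] \<epsilon> by auto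
  obtain q where q: "q \<in> \<rat>" "h x - \<epsilon> < q" "q < h x" using Rats_dense_in_real[of "h x - \<epsilon>" "h x"] \<epsilon> by auto
  have "straddles h p x \<or> straddles h q x"
  proof (rule ccontr)
    assume "\<not> ?thesis"
    then obtain T U where T: "open T" "x \<in> T" "\<And>u v. u \<in> T \<Longrightarrow> v \<in> T \<Longrightarrow> \<not> (h u < p \<and> p < h v)"
      and U: "open U" "x \<in> U" "\<And>u v. u \<in> U \<Longrightarrow> v \<in> U \<Longrightarrow> \<not> (h u < q \<and> q < h v)"
      unfolding straddles_def by metis
    have "open (T \<inter> U)" "x \<in> T \<inter> U" using T U by auto
    then obtain \<delta> where \<delta>: "0 < \<delta>" "ball x \<delta> \<subseteq> T \<inter> U" by (metis open_contains_ball)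
    obtain y where y: "dist y x < \<delta>" "\<epsilon> \<le> dist (h y) (h x)" using far[OF \<delta>(1)] by blast
    then have "y \<in> ball x \<delta>" by (simp add: dist_commute)
    then have "y \<in> T" "y \<in> U" using \<delta>(2) by auto
    then have "\<not> p < h y" "\<not> h y < q" using T(3)[of x y] U(3)[of y x] T(2) U(2) p q by auto
    then show False using y(2) p q by (auto simp: dist_real_def)
  qed
  then show ?thesis using that p(1) q(1) by blast
qed

text \<open>Pigeonhole over the countably many rational levels.\<close>

lemma common_straddling_level:
  assumes "uncountable {x. \<not> isCont h x}"
  obtains p where "infinite {x. straddles h p x}"
proof -
  have "{x. \<not> isCont h x} \<subseteq> (\<Union>p\<in>\<rat>. {x. straddles h p x})"
  proof
    fix x assume "x \<in> {x. \<not> isCont h x}"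
    then show "x \<in> (\<Union>p\<in>\<rat>. {x. straddles h p x})"
      by (auto elim: straddles_if_not_isCont)
  qed
  then have "uncountable (\<Union>p\<in>\<rat>. {x. straddles h p x})"
    using assms by (metis countable_subset)
  then obtain p where "uncountable {x. straddles h p x}"
    using countable_rat by blast
  then have "infinite {x. straddles h p x}" using countable_finite by metis
  then show ?thesis by (rule that)
qed

text \<open>Positions are blocks of two points: picking \<open>u\<close> or \<open>v\<close> freely
  in each block keeps the order between blocks. The order inside a block is left open, since
  straddling gives no control over it.\<close>

definition below :: "(nat \<Rightarrow> real) \<Rightarrow> (nat \<Rightarrow> real) \<Rightarrow> nat \<Rightarrow> nat \<Rightarrow> bool" where
  "below u v l m \<longleftrightarrow> u l < u m \<and> u l < v m \<and> v l < u m \<and> v l < v m"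

text \<open>A monotone sequence of straddled points may increase or decrease, hence the two
  alternatives.\<close>

lemma straddling_sequences:
  assumes "infinite {x. straddles h p x}"
  shows "\<exists>u v. (\<forall>n. h (u n) < p \<and> p < h (v n)) \<and>
    ((\<forall>l m. l < m \<longrightarrow> below u v l m) \<or> (\<forall>l m. l < m \<longrightarrow> below u v m l))"
proof -
  obtain s0 :: "nat \<Rightarrow> real" where s0: "inj s0" "range s0 \<subseteq> {x. straddles h p x}"
    using infinite_countable_subset[OF assms] by blast
  obtain f where f: "strict_mono f" "monoseq (\<lambda>n. s0 (f n))" using seq_monosub by blast
  define s where "s n = s0 (f n)" for n
  have str: "straddles h p (s n)" for n using s0(2) by (auto simp: s_def)
  have "inj s"
    unfolding s_def using inj_compose[OF s0(1) strict_mono_imp_inj_on[OF f(1)]] by (simp add: comp_def)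
  then have ne: "s m \<noteq> s n" if "m \<noteq> n" for m n using that by (simp add: inj_eq)
  have choose: "\<exists>u v. u \<in> T \<and> v \<in> T \<and> h u < p \<and> p < h v" if "open T" "s n \<in> T" for T n
    using str[of n] that unfolding straddles_def by blast
  from f(2) have "(\<forall>m n. m \<le> n \<longrightarrow> s m \<le> s n) \<or> (\<forall>m n. m \<le> n \<longrightarrow> s n \<le> s m)"
    by (auto simp: monoseq_def s_def)
  then show ?thesis
  proof
    assume le: "\<forall>m n. m \<le> n \<longrightarrow> s m \<le> s n"
    have less: "s m < s n" if "m < n" for m n using le ne[of m n] that by (simp add: order_less_le)
    \<comment> \<open>Even members of the sequence serve as separators: each pair is picked near the
      odd member between two of them, so different pairs lie in disjoint intervals.\<close>
    have "\<exists>u v. u \<in> {s (2*n)<..<s (2*n+2)} \<and> v \<in> {s (2*n)<..<s (2*n+2)} \<and> h u < p \<and> p < h v" for n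
      by (rule choose[of _ "2*n+1"]) (auto intro: less)
    then obtain u v where uv: "\<And>n. u n \<in> {s (2*n)<..<s (2*n+2)}" "\<And>n. v n \<in> {s (2*n)<..<s (2*n+2)}"
      "\<And>n. h (u n) < p" "\<And>n. p < h (v n)" by metis
    have "below u v l m" if "l < m" for l m
    proof -
      have "s (2*l+2) \<le> s (2*m)" using le that by simp
      then show ?thesis using uv(1)[of l] uv(1)[of m] uv(2)[of l] uv(2)[of m] by (simp add: below_def)
    qed
    then show ?thesis using uv(3,4) by (intro exI[of _ u] exI[of _ v]) simp
  next
    assume le: "\<forall>m n. m \<le> n \<longrightarrow> s n \<le> s m"
    have less: "s n < s m" if "m < n" for m n using le ne[of m n] that by (simp add: order_less_le)
    have "\<exists>u v. u \<in> {s (2*n+2)<..<s (2*n)} \<and> v \<in> {s (2*n+2)<..<s (2*n)} \<and> h u < p \<and> p < h v" for n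
      by (rule choose[of _ "2*n+1"]) (auto intro: less)
    then obtain u v where uv: "\<And>n. u n \<in> {s (2*n+2)<..<s (2*n)}" "\<And>n. v n \<in> {s (2*n+2)<..<s (2*n)}"
      "\<And>n. h (u n) < p" "\<And>n. p < h (v n)" by metis
    have "below u v m l" if "l < m" for l m
    proof -
      have "s (2*m) \<le> s (2*l+2)" using le that by simp
      then show ?thesis using uv(1)[of l] uv(1)[of m] uv(2)[of l] uv(2)[of m] by (simp add: below_def)
    qed
    then show ?thesis using uv(3,4) by (intro exI[of _ u] exI[of _ v]) simp
  qed
qed

section \<open>Finite configurations and the permutations they generate\<close>

definition inc_below :: "nat \<Rightarrow> (nat \<Rightarrow> real) \<Rightarrow> bool" where
  "inc_below k s \<longleftrightarrow> (\<forall>l m. l < m \<longrightarrow> m < k \<longrightarrow> s l < s m)"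

definition dec_below :: "nat \<Rightarrow> (nat \<Rightarrow> real) \<Rightarrow> bool" where
  "dec_below k s \<longleftrightarrow> (\<forall>l m. l < m \<longrightarrow> m < k \<longrightarrow> s m < s l)"

lemma monoseq_inj_cases:
  assumes "monoseq s" "inj s"
  shows "(\<forall>l m. l < m \<longrightarrow> s l < s m) \<or> (\<forall>l m. l < m \<longrightarrow> (s m :: real) < s l)"
proof -
  have ne: "s m \<noteq> s n" if "m \<noteq> n" for m n using assms(2) that by (simp add: inj_eq)
  from assms(1) show ?thesis
    unfolding monoseq_def
  proof
    assume "\<forall>m. \<forall>n\<ge>m. s m \<le> s n"
    then have "\<forall>l m. l < m \<longrightarrow> s l < s m" using ne by (simp add: order_less_le)
    then show ?thesis ..
  next
    assume "\<forall>m. \<forall>n\<ge>m. s n \<le> s m"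
    then have "\<forall>l m. l < m \<longrightarrow> s m < s l" using ne by (simp add: order_less_le)
    then show ?thesis ..
  qed
qed

text \<open>Passing to subsequences makes the values monotone along \<open>u\<close> and along
  \<open>v\<close>. Restricting to \<open>k\<close> positions allows a descending configuration to
  be read backwards, so that positions always increase.\<close>

lemma straddling_configuration:
  fixes h :: "real \<Rightarrow> real"
  assumes h: "inj h" "uncountable {x. \<not> isCont h x}"
  shows "\<exists>u v. (\<forall>l m. l < m \<longrightarrow> m < k \<longrightarrow> below u v l m) \<and> (\<forall>l m. h (u l) < h (v m)) \<and>
    (inc_below k (\<lambda>n. h (u n)) \<or> dec_below k (\<lambda>n. h (u n))) \<and>
    (inc_below k (\<lambda>n. h (v n)) \<or> dec_below k (\<lambda>n. h (v n)))"
proof -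
  obtain p where "infinite {x. straddles h p x}" using common_straddling_level[OF h(2)] .
  then obtain u0 v0 where uv0: "\<And>n. h (u0 n) < p" "\<And>n. p < h (v0 n)"
    and bel0: "(\<forall>l m. l < m \<longrightarrow> below u0 v0 l m) \<or> (\<forall>l m. l < m \<longrightarrow> below u0 v0 m l)"
    using straddling_sequences by metis
  obtain f where f: "strict_mono f" "monoseq (\<lambda>n. h (u0 (f n)))"
    using seq_monosub[of "\<lambda>n. h (u0 n)"] by blast
  obtain g where g: "strict_mono g" "monoseq (\<lambda>n. h (v0 (f (g n))))"
    using seq_monosub[of "\<lambda>n. h (v0 (f n))"] by blast
  define u v where "u n = u0 (f (g n))" and "v n = v0 (f (g n))" for n
  have fg: "f (g l) < f (g m)" if "l < m" for l m
    using that f(1) g(1) by (simp add: strict_mono_less)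
  have bel: "(\<forall>l m. l < m \<longrightarrow> below u v l m) \<or> (\<forall>l m. l < m \<longrightarrow> below u v m l)"
    using bel0
  proof
    assume "\<forall>l m. l < m \<longrightarrow> below u0 v0 l m"
    then have "\<forall>l m. l < m \<longrightarrow> below u v l m" using fg by (simp add: below_def u_def v_def)
    then show ?thesis ..
  next
    assume "\<forall>l m. l < m \<longrightarrow> below u0 v0 m l"
    then have "\<forall>l m. l < m \<longrightarrow> below u v m l" using fg by (simp add: below_def u_def v_def)
    then show ?thesis ..
  qed
  have uv: "h (u l) < h (v m)" for l m
    using uv0(1)[of "f (g l)"] uv0(2)[of "f (g m)"] by (simp add: u_def v_def)
  have ne: "u l \<noteq> u m \<and> v l \<noteq> v m" if "l \<noteq> m" for l m
  proof (cases "l < m")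
    case True
    then show ?thesis using bel unfolding below_def by (metis less_irrefl)
  next
    case False
    then have "m < l" using that by simp
    then show ?thesis using bel unfolding below_def by (metis less_irrefl)
  qed
  have "inj u" "inj v" using ne unfolding inj_def by metis+
  then have inj: "inj (\<lambda>n. h (u n))" "inj (\<lambda>n. h (v n))"
    using inj_compose[OF h(1)] by (simp_all add: comp_def)
  have "monoseq (\<lambda>n. h (u n))"
    proof -
    have "g m \<le> g n" if "m \<le> n" for m n using that g(1) by (simp add: strict_mono_less_eq)
    then show ?thesis using f(2) unfolding monoseq_def u_def by metis
  qed
  moreover have "monoseq (\<lambda>n. h (v n))" using g(2) by (simp add: v_def)
  ultimately have mono: "(\<forall>l m. l < m \<longrightarrow> h (u l) < h (u m)) \<or> (\<forall>l m. l < m \<longrightarrow> h (u m) < h (u l))"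
    "(\<forall>l m. l < m \<longrightarrow> h (v l) < h (v m)) \<or> (\<forall>l m. l < m \<longrightarrow> h (v m) < h (v l))"
    using monoseq_inj_cases inj by simp_all
  show ?thesis
    using bel
  proof
    assume "\<forall>l m. l < m \<longrightarrow> below u v l m"
    then show ?thesis
      using uv mono unfolding inc_below_def dec_below_def by (intro exI[of _ u] exI[of _ v]) auto
  next
    assume b: "\<forall>l m. l < m \<longrightarrow> below u v m l"
    \<comment> \<open>Only indices below \<open>k\<close> are reflected properly; beyond, truncated
      subtraction gives 0, which is harmless because the comparison of \<open>u\<close> with
      \<open>v\<close> values holds for all indices.\<close>
    let ?r = "\<lambda>n. k - 1 - n"
    have r: "?r m < ?r l" if "l < m" "m < k" for l m using that by auto
    show ?thesis
    proof (rule exI[of _ "\<lambda>n. u (?r n)"], rule exI[of _ "\<lambda>n. v (?r n)"], intro conjI allI impI)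
      show "below (\<lambda>n. u (?r n)) (\<lambda>n. v (?r n)) l m" if "l < m" "m < k" for l m
        using b r[OF that] by (simp add: below_def)
      show "h (u (?r l)) < h (v (?r m))" for l m by (rule uv)
      show "inc_below k (\<lambda>n. h (u (?r n))) \<or> dec_below k (\<lambda>n. h (u (?r n)))"
        using mono(1) r unfolding inc_below_def dec_below_def by metis
      show "inc_below k (\<lambda>n. h (v (?r n))) \<or> dec_below k (\<lambda>n. h (v (?r n)))"
        using mono(2) r unfolding inc_below_def dec_below_def by metis
    qed
  qed
qed

text \<open>The permutation sends an index to the number of smaller values, so it records the order
  pattern of \<open>b\<close>.\<close>

lemma rank_permutation:
  fixes b :: "nat \<Rightarrow> real"
  assumes b: "inj_on b {..<k}"
  obtains \<pi> where "\<pi> permutes {..<k}" "\<And>l m. l < k \<Longrightarrow> m < k \<Longrightarrow> b l < b m \<Longrightarrow> \<pi> l < \<pi> m"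
proof -
  define \<pi> where "\<pi> l = (if l < k then card {m. m < k \<and> b m < b l} else l)" for l
  have less: "\<pi> l < \<pi> m" if "l < k" "m < k" "b l < b m" for l m
  proof -
    have "{i. i < k \<and> b i < b l} \<subset> {i. i < k \<and> b i < b m}" using that by auto
    then show ?thesis using that by (simp add: \<pi>_def psubset_card_mono)
  qed
  have "inj_on \<pi> {..<k}"
  proof (rule inj_onI)
    fix l m assume lm: "l \<in> {..<k}" "m \<in> {..<k}" "\<pi> l = \<pi> m"
    then have "b l = b m" using less[of l m] less[of m l] by force
    then show "l = m" using b lm by (simp add: inj_on_def)
  qed
  moreover have "\<pi> ` {..<k} \<subseteq> {..<k}"
  proof
    fix y assume "y \<in> \<pi> ` {..<k}"
    then obtain l where l: "l < k" "y = \<pi> l" by auto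
    have "{m. m < k \<and> b m < b l} \<subset> {..<k}" using l by auto
    then have "card {m. m < k \<and> b m < b l} < card {..<k}" by (rule psubset_card_mono[rotated]) simp
    then show "y \<in> {..<k}" using l by (simp add: \<pi>_def)
  qed
  ultimately have "bij_betw \<pi> {..<k} {..<k}"
    by (simp add: bij_betw_def endo_inj_surj)
  then have "\<pi> permutes {..<k}" by (rule bij_imp_permutes) (simp add: \<pi>_def)
  then show ?thesis using that less by blast
qed

text \<open>Conjugating the transposition of \<open>a\<close> and \<open>b\<close> by that of
  \<open>b\<close> and \<open>Suc b\<close> moves its upper end by one; products suffice, as
  transpositions are their own inverses.\<close>

lemma transposition_from_adjacent:
  assumes adj: "\<And>j. Suc j < k \<Longrightarrow> Transposition.transpose j (Suc j) \<in> G"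
    and comp: "\<And>\<sigma> \<tau>. \<sigma> \<in> G \<Longrightarrow> \<tau> \<in> G \<Longrightarrow> \<sigma> \<circ> \<tau> \<in> G"
    and "a < b" "b < k"
  shows "Transposition.transpose a b \<in> G"
  using assms(3,4)
proof (induction b)
  case (Suc b)
  show ?case
  proof (cases "a = b")
    case True
    then show ?thesis using adj Suc.prems by simp
  next
    case False
    then have "Transposition.transpose a b \<in> G" using Suc by simp
    moreover have t: "Transposition.transpose b (Suc b) \<in> G" using adj Suc.prems by simp
    moreover have "Transposition.transpose a (Suc b)
      = Transposition.transpose b (Suc b) \<circ> (Transposition.transpose a b \<circ> Transposition.transpose b (Suc b))"
      using False Suc.prems by (auto simp: fun_eq_iff Transposition.transpose_def)
    ultimately show ?thesis using comp by metis
  qed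
qed simp

text \<open>The position \<open>l\<close> may be filled by \<open>u l\<close> or by \<open>v l\<close>; the patterns obtained in this way are
  adjacent transpositions, their products with the reversal, or reversals of final or initial segments,
  according to the directions of the two sequences.\<close>

lemma adjacent_transpositions_from_configuration:
  fixes h :: "real \<Rightarrow> real"
  assumes bel: "\<And>l m. l < m \<Longrightarrow> m < k \<Longrightarrow> below u v l m"
    and uv: "\<And>l m. h (u l) < h (v m)"
    and mu: "inc_below k (\<lambda>n. h (u n)) \<or> dec_below k (\<lambda>n. h (u n))"
    and mv: "inc_below k (\<lambda>n. h (v n)) \<or> dec_below k (\<lambda>n. h (v n))"
    and realized: "\<And>\<sigma> w. \<sigma> permutes {..<k} \<Longrightarrow> inc_below k w \<Longrightarrow>
      (\<And>l m. l < k \<Longrightarrow> m < k \<Longrightarrow> \<sigma> l < \<sigma> m \<Longrightarrow> h (w l) < h (w m)) \<Longrightarrow> \<sigma> \<in> G"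
    and comp: "\<And>\<sigma> \<tau>. \<sigma> \<in> G \<Longrightarrow> \<tau> \<in> G \<Longrightarrow> \<sigma> \<circ> \<tau> \<in> G"
    and j: "Suc j < k"
  shows "Transposition.transpose j (Suc j) \<in> G"
proof -
  have permI: "\<sigma> permutes {..<k}" if "\<And>x. \<sigma> (\<sigma> x) = x" "\<And>x. x \<ge> k \<Longrightarrow> \<sigma> x = x" for \<sigma> :: "nat \<Rightarrow> nat"
    unfolding permutes_def using that by (metis lessThan_iff not_less)
  have tp: "Transposition.transpose j (Suc j) permutes {..<k}"
    using j by (intro permutes_swap_id) auto
  have choice: "inc_below k (\<lambda>l. if A l then v l else u l)" for A
    unfolding inc_below_def using bel by (auto simp: below_def)
  consider "inc_below k (\<lambda>n. h (u n))" "inc_below k (\<lambda>n. h (v n))"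
    | "dec_below k (\<lambda>n. h (u n))" "dec_below k (\<lambda>n. h (v n))"
    | "inc_below k (\<lambda>n. h (u n))" "dec_below k (\<lambda>n. h (v n))"
    | "dec_below k (\<lambda>n. h (u n))" "inc_below k (\<lambda>n. h (v n))"
    using mu mv by blast
  then show ?thesis
  proof cases
    case 1
    \<comment> \<open>All \<open>u\<close> values lie below all \<open>v\<close> values. Taking
      \<open>u\<close> before \<open>j\<close> and at \<open>Suc j\<close>, and \<open>v\<close>
      elsewhere, ranks the positions as usual except that \<open>Suc j\<close> precedes
      \<open>j\<close>.\<close>
    show ?thesis
    proof (rule realized[OF tp choice[of "\<lambda>l. l = j \<or> Suc j < l"]])
      fix l m
      assume lm: "l < k" "m < k" "Transposition.transpose j (Suc j) l < Transposition.transpose j (Suc j) m"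
      show "h (if l = j \<or> Suc j < l then v l else u l) < h (if m = j \<or> Suc j < m then v m else u m)"
        using lm 1 uv unfolding inc_below_def Transposition.transpose_def by (auto split: if_splits)
    qed
  next
    case 2
    define \<rho> where "\<rho> l = (if l < k then k - 1 - l else l)" for l
    have \<rho>: "\<rho> permutes {..<k}" by (rule permI) (auto simp: \<rho>_def)
    have "\<rho> \<in> G"
    proof (rule realized[OF \<rho> choice[of "\<lambda>_. False"]])
      show "h (if False then v l else u l) < h (if False then v m else u m)"
        if "l < k" "m < k" "\<rho> l < \<rho> m" for l m
        using that 2 by (auto simp: dec_below_def \<rho>_def)
    qed
    \<comment> \<open>Both sequences decrease, so any choice reverses within each level; the choice
      here gives the reversal with \<open>j\<close> and \<open>Suc j\<close> exchanged, and
      composing with \<open>\<rho>\<close> cancels the reversal.\<close>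
    moreover have "\<rho> \<circ> Transposition.transpose j (Suc j) \<in> G"
    proof (rule realized[OF permutes_compose[OF tp \<rho>] choice[of "\<lambda>l. l < j \<or> l = Suc j"]])
      fix l m
      assume lm: "l < k" "m < k"
        "(\<rho> \<circ> Transposition.transpose j (Suc j)) l < (\<rho> \<circ> Transposition.transpose j (Suc j)) m"
      then have "Transposition.transpose j (Suc j) m < Transposition.transpose j (Suc j) l"
        using j unfolding \<rho>_def Transposition.transpose_def by (auto split: if_splits)
      then show "h (if l < j \<or> l = Suc j then v l else u l) < h (if m < j \<or> m = Suc j then v m else u m)"
        using lm 2 uv unfolding dec_below_def Transposition.transpose_def by (auto split: if_splits)
    qed
    ultimately have "\<rho> \<circ> (\<rho> \<circ> Transposition.transpose j (Suc j)) \<in> G" by (rule comp)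
    moreover have "\<rho> \<circ> (\<rho> \<circ> Transposition.transpose j (Suc j)) = Transposition.transpose j (Suc j)"
      by (auto simp: fun_eq_iff \<rho>_def)
    ultimately show ?thesis by simp
  next
    case 3
    \<comment> \<open>\<open>R i\<close> reverses the final segment starting at \<open>i\<close>:
      increasing \<open>u\<close> before \<open>i\<close>, decreasing \<open>v\<close> from
      \<open>i\<close> on.\<close>
    define R where "R i l = (if i \<le> l \<and> l < k then i + k - 1 - l else l)" for i l
    have R: "R i \<in> G" if "i < k" for i
    proof (rule realized[OF _ choice[of "\<lambda>l. i \<le> l"]])
      show "R i permutes {..<k}" by (rule permI) (auto simp: R_def)
      show "h (if i \<le> l then v l else u l) < h (if i \<le> m then v m else u m)"
        if lm: "l < k" "m < k" "R i l < R i m" for l m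
      proof (cases "i \<le> l"; cases "i \<le> m")
        assume "i \<le> l" "i \<le> m"
        then have "m < l" using lm by (simp add: R_def)
        then show ?thesis using \<open>i \<le> l\<close> \<open>i \<le> m\<close> lm 3 by (simp add: dec_below_def)
      next
        assume "\<not> i \<le> l" "\<not> i \<le> m"
        then have "l < m" using lm by (simp add: R_def)
        then show ?thesis using \<open>\<not> i \<le> l\<close> \<open>\<not> i \<le> m\<close> lm 3 by (simp add: inc_below_def)
      next
        assume "i \<le> l" "\<not> i \<le> m"
        then have False using lm by (simp add: R_def)
        then show ?thesis ..
      next
        assume "\<not> i \<le> l" "i \<le> m"
        then show ?thesis using uv by simp
      qed
    qed
    \<comment> \<open>\<open>R (k - 2)\<close> exchanges the last two positions, and
      \<open>R j\<close> carries these to \<open>Suc j\<close> and \<open>j\<close>.\<close>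
    have "R j \<circ> (R (k - 2) \<circ> R j) \<in> G"
      using j by (intro comp R) auto
    moreover have "R j \<circ> (R (k - 2) \<circ> R j) = Transposition.transpose j (Suc j)"
    proof
      fix x
      consider "x < j" | "x = j" | "x = Suc j" | "Suc j < x" "x < k" | "k \<le> x" by linarith
      then show "(R j \<circ> (R (k - 2) \<circ> R j)) x = Transposition.transpose j (Suc j) x"
        by cases (use j in \<open>auto simp: R_def Transposition.transpose_def\<close>)
    qed
    ultimately show ?thesis by simp
  next
    case 4
    \<comment> \<open>The mirror case: \<open>R i\<close> reverses the initial segment of length
      \<open>i\<close>. Then \<open>R 2\<close> exchanges positions 0 and 1, which
      \<open>R (j + 2)\<close> carries to \<open>Suc j\<close> and \<open>j\<close>.\<close>
    define R where "R i l = (if l < i then i - 1 - l else l)" for i l :: nat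
    have R: "R i \<in> G" if "i \<le> k" for i
    proof (rule realized[OF _ choice[of "\<lambda>l. i \<le> l"]])
      show "R i permutes {..<k}" by (rule permI) (use that in \<open>auto simp: R_def\<close>)
      show "h (if i \<le> l then v l else u l) < h (if i \<le> m then v m else u m)"
        if lm: "l < k" "m < k" "R i l < R i m" for l m
      proof (cases "i \<le> l"; cases "i \<le> m")
        assume "i \<le> l" "i \<le> m"
        then have "l < m" using lm by (simp add: R_def)
        then show ?thesis using \<open>i \<le> l\<close> \<open>i \<le> m\<close> lm 4 by (simp add: inc_below_def)
      next
        assume "\<not> i \<le> l" "\<not> i \<le> m"
        then have "m < l" using lm by (simp add: R_def)
        then show ?thesis using \<open>\<not> i \<le> l\<close> \<open>\<not> i \<le> m\<close> lm 4 by (simp add: dec_below_def)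
      next
        assume "i \<le> l" "\<not> i \<le> m"
        then have False using lm by (simp add: R_def)
        then show ?thesis ..
      next
        assume "\<not> i \<le> l" "i \<le> m"
        then show ?thesis using uv by simp
      qed
    qed
    have "R (j + 2) \<circ> (R 2 \<circ> R (j + 2)) \<in> G"
      using j by (intro comp R) auto
    moreover have "R (j + 2) \<circ> (R 2 \<circ> R (j + 2)) = Transposition.transpose j (Suc j)"
    proof
      fix x
      consider "x < j" | "x = j" | "x = Suc j" | "Suc j < x" by linarith
      then show "(R (j + 2) \<circ> (R 2 \<circ> R (j + 2))) x = Transposition.transpose j (Suc j) x"
        by cases (auto simp: R_def Transposition.transpose_def)
    qed
    ultimately show ?thesis by simp
  qed
qed

text \<open>\<open>Q\<close> depends only on order patterns and is preserved by \<open>F\<close>.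
  Each pattern that \<open>F\<close> produces from an increasing tuple is therefore a symmetry of
  \<open>Q\<close>, and the straddling configuration supplies enough of them to generate all
  permutations.\<close>

lemma order_invariant_constant:
  fixes Q :: "(nat \<Rightarrow> real) \<Rightarrow> bool" and e F :: "real \<Rightarrow> real"
  assumes iso: "\<And>b b'. b ` {..<k} \<subseteq> S \<Longrightarrow> b' ` {..<k} \<subseteq> S \<Longrightarrow> inj_on b {..<k} \<Longrightarrow>
      (\<And>l m. l < k \<Longrightarrow> m < k \<Longrightarrow> b l < b m \<Longrightarrow> b' l < b' m) \<Longrightarrow> Q b = Q b'"
    and inv: "\<And>b. b ` {..<k} \<subseteq> S \<Longrightarrow> Q (\<lambda>l. F (b l)) = Q b"
    and e: "strict_mono e" "range e \<subseteq> S"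
    and F: "inj_on F S" "F ` S \<subseteq> S"
    and disc: "uncountable {x. \<not> isCont (\<lambda>x. F (e x)) x}"
    and b: "b ` {..<k} \<subseteq> S" "inj_on b {..<k}" and b': "b' ` {..<k} \<subseteq> S" "inj_on b' {..<k}"
  shows "Q b = Q b'"
proof -
  define h where "h x = F (e x)" for x
  have eS: "e x \<in> S" for x using e(2) by auto
  have hS: "h x \<in> S" for x using eS F(2) by (auto simp: h_def)
  have e_less: "e x < e y \<longleftrightarrow> x < y" for x y using strict_mono_less[OF e(1)] .
  have "inj h"
  proof (rule injI)
    fix x y assume "h x = h y"
    then have "e x = e y" using F(1) eS by (simp add: h_def inj_on_def)
    then show "x = y" using strict_mono_eq[OF e(1)] by simp
  qed
  have "uncountable {x. \<not> isCont h x}" using disc by (simp add: h_def[abs_def])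
  then obtain u v where cfg: "\<And>l m. l < m \<Longrightarrow> m < k \<Longrightarrow> below u v l m" "\<And>l m. h (u l) < h (v m)"
    "inc_below k (\<lambda>n. h (u n)) \<or> dec_below k (\<lambda>n. h (u n))"
    "inc_below k (\<lambda>n. h (v n)) \<or> dec_below k (\<lambda>n. h (v n))"
    using straddling_configuration[OF \<open>inj h\<close>, of k] by metis
  define c where "c l = e (real l)" for l
  have c: "c l \<in> S" "c l < c m \<longleftrightarrow> l < m" "c l = c m \<longleftrightarrow> l = m" for l m
    using eS e_less strict_mono_eq[OF e(1)] by (simp_all add: c_def)
  \<comment> \<open>Permutations act here on values, since \<open>F\<close> moves values; demanding
    invariance for every \<open>\<pi>\<close> makes \<open>G\<close> closed under
    composition.\<close>
  define G where "G = {\<sigma>. \<sigma> permutes {..<k} \<and> (\<forall>\<pi>. \<pi> permutes {..<k} \<longrightarrow> Q (\<lambda>l. c (\<sigma> (\<pi> l))) = Q (\<lambda>l. c (\<pi> l)))}"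
  have G_D: "Q (\<lambda>l. c (\<sigma> (\<pi> l))) = Q (\<lambda>l. c (\<pi> l))" if "\<sigma> \<in> G" "\<pi> permutes {..<k}" for \<sigma> \<pi>
    using that unfolding G_def by blast
  have comp: "\<sigma> \<circ> \<tau> \<in> G" if "\<sigma> \<in> G" "\<tau> \<in> G" for \<sigma> \<tau>
  proof -
    have "\<sigma> \<circ> \<tau> permutes {..<k}" using that by (auto simp: G_def intro: permutes_compose)
    moreover have "Q (\<lambda>l. c ((\<sigma> \<circ> \<tau>) (\<pi> l))) = Q (\<lambda>l. c (\<pi> l))" if \<pi>: "\<pi> permutes {..<k}" for \<pi>
    proof -
      have "\<tau> \<circ> \<pi> permutes {..<k}" using \<open>\<tau> \<in> G\<close> \<pi> by (auto simp: G_def intro: permutes_compose)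
      then have "Q (\<lambda>l. c (\<sigma> ((\<tau> \<circ> \<pi>) l))) = Q (\<lambda>l. c ((\<tau> \<circ> \<pi>) l))"
        by (rule G_D[OF \<open>\<sigma> \<in> G\<close>])
      also have "\<dots> = Q (\<lambda>l. c (\<pi> l))" using G_D[OF \<open>\<tau> \<in> G\<close> \<pi>] by simp
      finally show ?thesis by simp
    qed
    ultimately show ?thesis by (simp add: G_def)
  qed
  have realized: "\<sigma> \<in> G" if \<sigma>: "\<sigma> permutes {..<k}" and w: "inc_below k w"
    and hw: "\<And>l m. l < k \<Longrightarrow> m < k \<Longrightarrow> \<sigma> l < \<sigma> m \<Longrightarrow> h (w l) < h (w m)" for \<sigma> w
  proof -
    have "Q (\<lambda>l. c (\<sigma> (\<pi> l))) = Q (\<lambda>l. c (\<pi> l))" if \<pi>: "\<pi> permutes {..<k}" for \<pi>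
    proof -
      have lt: "\<pi> l < k" if "l < k" for l using permutes_in_image[OF \<pi>, of l] that by simp
      \<comment> \<open>Three moves: replace \<open>c\<close> by the increasing tuple
        \<open>e \<circ> w\<close> with the same pattern, apply \<open>F\<close>, and recognise the
        pattern \<open>\<sigma> \<circ> \<pi>\<close> in the result.\<close>
      have "Q (\<lambda>l. c (\<pi> l)) = Q (\<lambda>l. e (w (\<pi> l)))"
      proof (rule iso)
        show "inj_on (\<lambda>l. c (\<pi> l)) {..<k}"
          using injD[OF permutes_inj[OF \<pi>]] by (intro inj_onI) (simp add: c(3))
        show "e (w (\<pi> l)) < e (w (\<pi> m))" if "l < k" "m < k" "c (\<pi> l) < c (\<pi> m)" for l m
          using that w lt by (simp add: c e_less inc_below_def)
      qed (auto simp: c eS)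
      also have "\<dots> = Q (\<lambda>l. F (e (w (\<pi> l))))"
        by (rule inv[symmetric]) (auto simp: eS)
      also have "\<dots> = Q (\<lambda>l. c (\<sigma> (\<pi> l)))"
      proof (rule iso[symmetric])
        show "inj_on (\<lambda>l. c (\<sigma> (\<pi> l))) {..<k}"
        proof (rule inj_onI)
          fix l m assume "c (\<sigma> (\<pi> l)) = c (\<sigma> (\<pi> m))"
          then have "\<sigma> (\<pi> l) = \<sigma> (\<pi> m)" by (simp only: c(3))
          then have "\<pi> l = \<pi> m" by (rule injD[OF permutes_inj[OF \<sigma>]])
          then show "l = m" by (rule injD[OF permutes_inj[OF \<pi>]])
        qed
        show "F (e (w (\<pi> l))) < F (e (w (\<pi> m)))" if "l < k" "m < k" "c (\<sigma> (\<pi> l)) < c (\<sigma> (\<pi> m))" for l m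
          using hw[of "\<pi> l" "\<pi> m"] that lt by (simp add: c h_def)
      qed (use hS in \<open>auto simp: c h_def\<close>)
      finally show ?thesis by simp
    qed
    then show ?thesis using \<sigma> by (simp add: G_def)
  qed
  have adj: "Transposition.transpose j (Suc j) \<in> G" if "Suc j < k" for j
    by (rule adjacent_transpositions_from_configuration[OF cfg realized comp that])
  have tr: "Transposition.transpose i j \<in> G" if "i < k" "j < k" "i \<noteq> j" for i j
  proof (cases "i < j")
    case True
    show ?thesis by (rule transposition_from_adjacent[OF adj comp True that(2)])
  next
    case False
    then have "j < i" using that by simp
    have "Transposition.transpose j i \<in> G"
      by (rule transposition_from_adjacent[OF adj comp \<open>j < i\<close> that(1)])
    then show ?thesis by (simp add: transpose_commute)
  qed
  have all: "\<pi> \<in> G" if "\<pi> permutes {..<k}" for \<pi>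
    using that finite_lessThan
  proof (induction \<pi> rule: permutes_induct)
    case id
    then show ?case using permutes_id[of "{..<k}"] by (simp add: G_def id_def)
  next
    case (swap i j \<pi>)
    then show ?case by (intro comp tr) auto
  qed
  have "Q b = Q c" if b: "b ` {..<k} \<subseteq> S" "inj_on b {..<k}" for b
  proof -
    obtain \<pi> where \<pi>: "\<pi> permutes {..<k}" "\<And>l m. l < k \<Longrightarrow> m < k \<Longrightarrow> b l < b m \<Longrightarrow> \<pi> l < \<pi> m"
      using rank_permutation[OF b(2)] by blast
    have "Q b = Q (\<lambda>l. c (\<pi> l))"
      using b \<pi>(2) by (intro iso) (auto simp: c)
    also have "\<dots> = Q (\<lambda>l. c l)"
      using G_D[OF all[OF \<pi>(1)] permutes_id] by simp
    finally show ?thesis .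
  qed
  then show ?thesis using b b' by simp
qed

section \<open>Copies of chained structures\<close>

locale real_chain =
  fixes X :: "('i, 'x) rel_struct" and r :: "'x rel" and \<phi> :: "'x \<Rightarrow> real" and S :: "real set"
  assumes chained: "chained_by X r"
    and \<phi>_bij: "bij_betw \<phi> (univ X) S"
    and r_iff: "x \<in> univ X \<Longrightarrow> y \<in> univ X \<Longrightarrow> (x, y) \<in> r \<longleftrightarrow> \<phi> x < \<phi> y"
begin

definition \<psi> :: "real \<Rightarrow> 'x" where
  "\<psi> = inv_into (univ X) \<phi>"

lemma \<psi>_\<phi>: "x \<in> univ X \<Longrightarrow> \<psi> (\<phi> x) = x"
  using \<phi>_bij by (simp add: \<psi>_def bij_betw_def)

lemma \<phi>_\<psi>: "s \<in> S \<Longrightarrow> \<phi> (\<psi> s) = s"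
  using \<phi>_bij by (simp add: \<psi>_def bij_betw_def f_inv_into_f)

lemma \<psi>_univ: "s \<in> S \<Longrightarrow> \<psi> s \<in> univ X"
  using \<phi>_bij by (metis \<psi>_def bij_betw_def inv_into_into)

lemma \<phi>_S: "x \<in> univ X \<Longrightarrow> \<phi> x \<in> S"
  using \<phi>_bij by (auto simp: bij_betw_def)

lemma \<phi>_eq_iff: "x \<in> univ X \<Longrightarrow> y \<in> univ X \<Longrightarrow> \<phi> x = \<phi> y \<longleftrightarrow> x = y"
  using \<psi>_\<phi> by metis

text \<open>Chainedness enters here: a map increasing with respect to \<open>\<phi>\<close> also
  reflects the order, as the order is total, and so is a partial automorphism of the chain.\<close>

lemma increasing_preserves_interp:
  assumes A: "A \<subseteq> univ X" and gA: "g ` A \<subseteq> univ X"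
    and inc: "\<And>x y. x \<in> A \<Longrightarrow> y \<in> A \<Longrightarrow> \<phi> x < \<phi> y \<Longrightarrow> \<phi> (g x) < \<phi> (g y)"
  shows "inj_on g A"
    and "length xs = arity X i \<Longrightarrow> set xs \<subseteq> A \<Longrightarrow> xs \<in> interp X i \<longleftrightarrow> map g xs \<in> interp X i"
proof -
  have iff: "\<phi> x < \<phi> y \<longleftrightarrow> \<phi> (g x) < \<phi> (g y)" if "x \<in> A" "y \<in> A" for x y
  proof (cases "\<phi> x < \<phi> y")
    case True
    then show ?thesis using inc that by simp
  next
    case False
    moreover have "\<phi> x = \<phi> y \<Longrightarrow> x = y" using \<phi>_eq_iff[of x y] that A by blast
    ultimately consider "\<phi> y < \<phi> x" | "x = y" by linarith
    then show ?thesis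
    proof cases
      case 1
      then show ?thesis using inc[OF that(2,1)] by simp
    qed simp
  qed
  show inj: "inj_on g A"
  proof (rule inj_onI)
    fix x y assume xy: "x \<in> A" "y \<in> A" "g x = g y"
    then have "\<not> \<phi> x < \<phi> y" "\<not> \<phi> y < \<phi> x" using iff by auto
    then have "\<phi> x = \<phi> y" by simp
    then show "x = y" using \<phi>_eq_iff xy A by blast
  qed
  have r: "(x, y) \<in> r \<longleftrightarrow> (g x, g y) \<in> r" if "x \<in> A" "y \<in> A" for x y
  proof -
    have "x \<in> univ X" "y \<in> univ X" "g x \<in> univ X" "g y \<in> univ X" using that A gA by auto
    then show ?thesis using iff[OF that] r_iff by simp
  qed
  have "partial_automorphism (order_structure (univ X) r) A (g ` A) g"
    unfolding partial_automorphism_def isomorphism_def embedding_def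
  proof (intro conjI allI impI)
    fix i :: unit and ys
    assume "length ys = arity (substructure (order_structure (univ X) r) A) i"
      and ysA: "set ys \<subseteq> univ (substructure (order_structure (univ X) r) A)"
    then have "length ys = 2" by (simp add: substructure_def order_structure_def)
    then obtain x y where ys: "ys = [x, y]"
      by (metis (no_types, opaque_lifting) One_nat_def Suc_1 length_0_conv length_Suc_conv)
    then have "x \<in> A" "y \<in> A" using ysA by (simp_all add: substructure_def)
    then show "ys \<in> interp (substructure (order_structure (univ X) r) A) i \<longleftrightarrow>
        map g ys \<in> interp (substructure (order_structure (univ X) r) (g ` A)) i"
      using r by (simp add: ys substructure_def order_structure_def)
  qed (use A gA inj in \<open>simp_all add: substructure_def order_structure_def\<close>)
  then have pa: "partial_automorphism X A (g ` A) g"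
    using chained unfolding chained_by_def by blast
  show "xs \<in> interp X i \<longleftrightarrow> map g xs \<in> interp X i" if xs: "length xs = arity X i" "set xs \<subseteq> A"
  proof -
    have "xs \<in> interp (substructure X A) i \<longleftrightarrow> map g xs \<in> interp (substructure X (g ` A)) i"
      using pa xs unfolding partial_automorphism_def isomorphism_def embedding_def
      by (simp add: substructure_def)
    moreover have "g ` set xs \<subseteq> g ` A" using xs(2) by blast
    ultimately show ?thesis using xs(2) by (simp add: substructure_def)
  qed
qed

text \<open>The increasing map into \<open>A\<close> is defined on all of \<real>; restricted to
  \<open>S\<close> it is an increasing self-map of the chain, hence a self-embedding of
  \<open>X\<close>.\<close>

lemma fat_contains_copy:
  assumes "fat A" "A \<subseteq> S"
  obtains C where "C \<in> copies X" "\<phi> ` C \<subseteq> A"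
proof -
  obtain e :: "real \<Rightarrow> real" where e: "strict_mono e" "range e \<subseteq> A"
    using assms(1) unfolding fat_def by metis
  have eA: "e x \<in> A" "e x \<in> S" for x using e(2) assms(2) by auto
  define g where "g x = \<psi> (e (\<phi> x))" for x
  have g: "g ` univ X \<subseteq> univ X" using eA \<psi>_univ by (auto simp: g_def)
  have \<phi>g: "\<phi> (g x) = e (\<phi> x)" for x using \<phi>_\<psi> eA by (simp add: g_def)
  have inc: "\<phi> (g x) < \<phi> (g y)" if "\<phi> x < \<phi> y" for x y
    using that strict_mono_less[OF e(1)] by (simp add: \<phi>g)
  have "embedding X X g"
    unfolding embedding_def
    using increasing_preserves_interp[OF order_refl g inc] g by simp
  then have "g ` univ X \<in> copies X" unfolding copies_def by blast
  moreover have "\<phi> ` g ` univ X \<subseteq> A" using eA \<phi>g by auto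
  ultimately show ?thesis by (rule that)
qed

text \<open>For a fixed tuple, the truth of a relation is viewed as a predicate on placements of its
  distinct entries. It depends on the order pattern only and is preserved by \<open>f\<close>, so it
  agrees on all injective placements, in particular on the original one and its image under
  \<open>g\<close>.\<close>

lemma constant_if_discontinuous:
  fixes e :: "real \<Rightarrow> real"
  assumes f: "embedding X X f" and e: "strict_mono e" "range e \<subseteq> S"
    and disc: "uncountable {x. \<not> isCont (\<lambda>x. \<phi> (f (\<psi> (e x)))) x}"
  shows "constant_structure X"
  unfolding constant_structure_def isomorphism_def
proof (intro allI impI conjI)
  fix g assume g: "bij_betw g (univ X) (univ X)"
  then show "g ` univ X = univ X" by (simp add: bij_betw_def)
  have f_univ: "f x \<in> univ X" if "x \<in> univ X" for x using f that by (auto simp: embedding_def)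
  have g_univ: "g x \<in> univ X" if "x \<in> univ X" for x using g that by (auto simp: bij_betw_def)
  have "xs \<in> interp X i \<longleftrightarrow> map g xs \<in> interp X i"
    if xs: "length xs = arity X i" "set xs \<subseteq> univ X" for i xs
  proof -
    \<comment> \<open>Repeated entries are factored out: \<open>a\<close> lists the distinct entries
      and \<open>js\<close> records which one stands at each place, so placements can be taken
      injective.\<close>
    define k where "k = card (set xs)"
    obtain a where a: "bij_betw a {..<k} (set xs)"
      using ex_bij_betw_nat_finite[of "set xs"] by (auto simp: k_def atLeast0LessThan)
    define js where "js = map (inv_into {..<k} a) xs"
    have a_img: "a ` {..<k} = set xs" and a_inj: "inj_on a {..<k}"
      using a by (auto simp: bij_betw_def)
    have js: "set js \<subseteq> {..<k}" "length js = arity X i"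
      using xs(1) inv_into_into[of _ a "{..<k}"] by (auto simp: js_def a_img)
    have a_js: "map a js = xs"
      by (simp add: js_def a_img f_inv_into_f map_idI)
    have a_univ: "a l \<in> univ X" if "l < k" for l using that a_img xs(2) by blast
    define Q where "Q b \<longleftrightarrow> map (\<lambda>l. \<psi> (b l)) js \<in> interp X i" for b
    define F where "F s = \<phi> (f (\<psi> s))" for s
    have "Q (\<lambda>l. \<phi> (a l)) = Q (\<lambda>l. \<phi> (g (a l)))"
    proof (rule order_invariant_constant[where S = S and k = k and e = e and F = F])
      fix b b' :: "nat \<Rightarrow> real"
      assume b: "b ` {..<k} \<subseteq> S" and b': "b' ` {..<k} \<subseteq> S" and inj: "inj_on b {..<k}"
        and less: "\<And>l m. l < k \<Longrightarrow> m < k \<Longrightarrow> b l < b m \<Longrightarrow> b' l < b' m"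
      \<comment> \<open>\<open>t\<close> moves each point of the first placement to the
        corresponding point of the second; its values elsewhere do not matter.\<close>
      define t where "t x = \<psi> (b' (inv_into {..<k} b (\<phi> x)))" for x
      have bS: "b l \<in> S" "b' l \<in> S" if "l < k" for l using b b' that by auto
      have t: "t (\<psi> (b l)) = \<psi> (b' l)" if "l < k" for l
        using inj that bS by (simp add: t_def \<phi>_\<psi>)
      let ?A = "(\<lambda>l. \<psi> (b l)) ` {..<k}"
      have "map (\<lambda>l. \<psi> (b l)) js \<in> interp X i \<longleftrightarrow> map t (map (\<lambda>l. \<psi> (b l)) js) \<in> interp X i"
      proof (rule increasing_preserves_interp(2)[of ?A])
        show "?A \<subseteq> univ X" using bS \<psi>_univ by auto
        show "t ` ?A \<subseteq> univ X" using bS \<psi>_univ t by auto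
        show "\<phi> (t x) < \<phi> (t y)" if xy: "x \<in> ?A" "y \<in> ?A" "\<phi> x < \<phi> y" for x y
        proof -
          obtain l m where lm: "l < k" "m < k" "x = \<psi> (b l)" "y = \<psi> (b m)" using xy(1,2) by auto
          then have "b l < b m" using xy(3) bS by (simp add: \<phi>_\<psi>)
          then show ?thesis using less[OF lm(1,2)] lm bS by (simp add: t \<phi>_\<psi>)
        qed
        show "length (map (\<lambda>l. \<psi> (b l)) js) = arity X i" using js by simp
        show "set (map (\<lambda>l. \<psi> (b l)) js) \<subseteq> ?A" using js(1) by auto
      qed
      moreover have "map t (map (\<lambda>l. \<psi> (b l)) js) = map (\<lambda>l. \<psi> (b' l)) js"
        using js(1) t by auto
      ultimately show "Q b = Q b'" unfolding Q_def by (simp only:)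
    next
      fix b :: "nat \<Rightarrow> real" assume b: "b ` {..<k} \<subseteq> S"
      have bS: "b l \<in> S" if "l \<in> set js" for l using b that js(1) by auto
      have "map (\<lambda>l. \<psi> (F (b l))) js = map f (map (\<lambda>l. \<psi> (b l)) js)"
        using bS \<psi>_univ f_univ by (simp add: F_def \<psi>_\<phi>)
      moreover have "map (\<lambda>l. \<psi> (b l)) js \<in> interp X i \<longleftrightarrow> map f (map (\<lambda>l. \<psi> (b l)) js) \<in> interp X i"
      proof -
        have "length (map (\<lambda>l. \<psi> (b l)) js) = arity X i" "set (map (\<lambda>l. \<psi> (b l)) js) \<subseteq> univ X"
          using js bS \<psi>_univ by auto
        then show ?thesis using f unfolding embedding_def by blast
      qed
      ultimately show "Q (\<lambda>l. F (b l)) = Q b" unfolding Q_def by (simp only:)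
    next
      show "inj_on F S"
      proof (rule inj_onI)
        fix s t assume st: "s \<in> S" "t \<in> S" "F s = F t"
        then have "f (\<psi> s) = f (\<psi> t)" using \<phi>_eq_iff f_univ \<psi>_univ by (simp add: F_def)
        then have "\<psi> s = \<psi> t" using f st \<psi>_univ by (simp add: embedding_def inj_on_def)
        then show "s = t" using \<phi>_\<psi> st by metis
      qed
      show "F ` S \<subseteq> S" using \<phi>_S f_univ \<psi>_univ by (auto simp: F_def)
      show "uncountable {x. \<not> isCont (\<lambda>x. F (e x)) x}" using disc by (simp add: F_def)
      show "(\<lambda>l. \<phi> (a l)) ` {..<k} \<subseteq> S" "(\<lambda>l. \<phi> (g (a l))) ` {..<k} \<subseteq> S"
        using a_univ g_univ \<phi>_S by auto
      show "inj_on (\<lambda>l. \<phi> (a l)) {..<k}"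
      proof (rule inj_onI)
        fix l m assume lm: "l \<in> {..<k}" "m \<in> {..<k}" "\<phi> (a l) = \<phi> (a m)"
        then have "a l = a m" using \<phi>_eq_iff a_univ by simp
        then show "l = m" using a_inj lm by (simp add: inj_on_def)
      qed
      show "inj_on (\<lambda>l. \<phi> (g (a l))) {..<k}"
      proof (rule inj_onI)
        fix l m assume lm: "l \<in> {..<k}" "m \<in> {..<k}" "\<phi> (g (a l)) = \<phi> (g (a m))"
        then have "g (a l) = g (a m)" using \<phi>_eq_iff a_univ g_univ by simp
        then have "a l = a m" using g a_univ lm by (simp add: bij_betw_def inj_on_def)
        then show "l = m" using a_inj lm by (simp add: inj_on_def)
      qed
    qed (use e in simp_all)
    moreover have "map (\<lambda>l. \<psi> (\<phi> (a l))) js = xs"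
    proof -
      have "map (\<lambda>l. \<psi> (\<phi> (a l))) js = map a js" using js(1) a_univ by (auto simp: \<psi>_\<phi>)
      then show ?thesis by (simp add: a_js)
    qed
    moreover have "map (\<lambda>l. \<psi> (\<phi> (g (a l)))) js = map g xs"
    proof -
      have "map (\<lambda>l. \<psi> (\<phi> (g (a l)))) js = map g (map a js)" using js(1) a_univ g_univ by (auto simp: \<psi>_\<phi>)
      then show ?thesis by (simp add: a_js)
    qed
    ultimately show ?thesis unfolding Q_def by (simp only:)
  qed
  then show "embedding X X g"
    using g unfolding embedding_def bij_betw_def by simp
qed

lemma copy_fat:
  assumes "\<not> constant_structure X" "fat S" "C \<in> copies X"
  shows "fat (\<phi> ` C)"
proof -
  obtain f where f: "embedding X X f" "C = f ` univ X" using assms(3) by (auto simp: copies_def)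
  obtain e :: "real \<Rightarrow> real" where e: "strict_mono e" "range e \<subseteq> S"
    using assms(2) unfolding fat_def by metis
  have eS: "e x \<in> S" for x using e(2) by auto
  have f_univ: "f x \<in> univ X" if "x \<in> univ X" for x using f that by (auto simp: embedding_def)
  define h where "h x = \<phi> (f (\<psi> (e x)))" for x
  have "inj h"
  proof (rule injI)
    fix x y assume "h x = h y"
    then have "f (\<psi> (e x)) = f (\<psi> (e y))" using \<phi>_eq_iff f_univ \<psi>_univ eS by (simp add: h_def)
    then have "\<psi> (e x) = \<psi> (e y)" using f \<psi>_univ eS by (simp add: embedding_def inj_on_def)
    then have "e x = e y" using \<phi>_\<psi> eS by metis
    then show "x = y" using strict_mono_eq[OF e(1)] by simp
  qed
  have hC: "range h \<subseteq> \<phi> ` C" using \<psi>_univ eS by (auto simp: h_def f(2))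
  define D where "D = {x. \<not> isCont h x}"
  have D: "countable D"
    using constant_if_discontinuous[OF f(1) e] assms(1) unfolding D_def h_def[abs_def] by blast
  have "- D \<in> sets borel"
    using countable_imp_null_set_lborel[OF D] by (metis borel_comp null_setsD2 sets_lborel)
  moreover have "uncountable (- D)"
    using uncountable_minus_countable[OF uncountable_UNIV_real D] by (simp add: Compl_eq_Diff_UNIV)
  ultimately obtain K where K: "perfect K" "K \<subseteq> - D"
    using uncountable_borel_perfect_fat by metis
  have cont: "continuous_on K h"
    using K(2) by (intro continuous_at_imp_continuous_on) (auto simp: D_def)
  \<comment> \<open>\<open>K\<close> is closed but possibly unbounded, so its image is obtained as a
    countable union of compact sets, which makes it Borel.\<close>
  have "compact (h ` (K \<inter> {- real n..real n}))" for n
    using K(1) by (intro compact_continuous_image continuous_on_subset[OF cont] closed_Int_compact)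
      (auto simp: perfect_def)
  then have "h ` (K \<inter> {- real n..real n}) \<in> sets borel" for n
    using borel_compact by blast
  then have "(\<Union>n. h ` (K \<inter> {- real n..real n})) \<in> sets borel" by blast
  moreover have "h ` K = (\<Union>n. h ` (K \<inter> {- real n..real n}))"
  proof (intro equalityI subsetI)
    fix y assume "y \<in> h ` K"
    then obtain x where x: "x \<in> K" "y = h x" by blast
    obtain n where "\<bar>x\<bar> \<le> real n" using real_arch_simple by blast
    then have "x \<in> K \<inter> {- real n..real n}" using x by auto
    then show "y \<in> (\<Union>n. h ` (K \<inter> {- real n..real n}))" using x(2) by blast
  qed blast
  moreover have "uncountable (h ` K)"
    using perfect_uncountable[OF K(1)] countable_image_inj_on[of h K] inj_on_subset[OF \<open>inj h\<close>]
    by blast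
  ultimately have "fat (h ` K)" using uncountable_borel_perfect_fat by metis
  then show ?thesis by (rule fat_mono) (use hC in blast)
qed

lemma dense_embedding_copies:
  assumes "\<not> constant_structure X" "fat S"
  shows "dense_embedding (copies_poset X) (fat_poset S) ((`) \<phi>)"
  unfolding copies_poset_def
proof (rule dense_embedding_family)
  have sub: "C \<subseteq> univ X" if "C \<in> copies X" for C
    using that by (auto simp: copies_def embedding_def)
  show "\<phi> ` C \<in> {A. A \<subseteq> S \<and> fat A}" if "C \<in> copies X" for C
    using copy_fat[OF assms that] sub[OF that] \<phi>_S by auto
  show "\<exists>C\<in>copies X. \<phi> ` C \<subseteq> B" if B: "B \<in> {A. A \<subseteq> S \<and> fat A}" for B
  proof -
    have "fat B" "B \<subseteq> S" using B by auto
    then obtain C where "C \<in> copies X" "\<phi> ` C \<subseteq> B" by (rule fat_contains_copy)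
    then show ?thesis by (rule bexI[rotated])
  qed
  show "\<exists>C\<in>copies X. C \<subseteq> A \<and> C \<subseteq> A'"
    if A: "A \<in> copies X" "A' \<in> copies X" and B: "B \<in> {A. A \<subseteq> S \<and> fat A}" "B \<subseteq> \<phi> ` A" "B \<subseteq> \<phi> ` A'" for A A' B
  proof -
    have "fat B" "B \<subseteq> S" using B(1) by auto
    then obtain C where C: "C \<in> copies X" "\<phi> ` C \<subseteq> B" by (rule fat_contains_copy)
    \<comment> \<open>\<open>\<phi>\<close> is injective on the domain, so inclusions between images
      pull back to the copies.\<close>
    have "C \<subseteq> E" if "E \<in> copies X" "\<phi> ` C \<subseteq> \<phi> ` E" for E
      using inj_on_image_subset_iff[of \<phi> "univ X" C E] \<phi>_bij sub C(1) that by (simp add: bij_betw_def)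
    then show ?thesis using A B C by (intro bexI[of _ C]) auto
  qed
qed auto

end

theorem theorem7p9:
  fixes X :: "('i, 'x) rel_struct" and r :: "'x rel" and S P :: "real set"
  assumes "rel_structure X"
    and "\<not> constant_structure X"
    and "r \<subseteq> univ X \<times> univ X" and "strict_linear_order_on (univ X) r"
    and "chained_by X r"
    and "isomorphic (order_structure (univ X) r) (substructure real_line S)"
    and "perfect P" and "P \<subseteq> S"
  shows "ba_isomorphic (copies_completion X) (ro sacks) \<and>
         ba_isomorphic (ro sacks) (ro (positive_poset borel_mod_countable))"
proof
  obtain \<phi> where \<phi>: "isomorphism (order_structure (univ X) r) (substructure real_line S) \<phi>"
    using assms(6) unfolding isomorphic_def by blast
  have bij: "bij_betw \<phi> (univ X) S"
    using \<phi> by (simp add: isomorphism_def embedding_def bij_betw_def order_structure_def substructure_def)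
  interpret real_chain X r \<phi> S
  proof
    show "chained_by X r" "bij_betw \<phi> (univ X) S" by fact+
    show "(x, y) \<in> r \<longleftrightarrow> \<phi> x < \<phi> y" if xy: "x \<in> univ X" "y \<in> univ X" for x y
    proof -
      have "\<phi> x \<in> S" "\<phi> y \<in> S" using bij xy by (auto simp: bij_betw_def)
      moreover have "\<forall>i xs. length xs = arity (order_structure (univ X) r) i \<longrightarrow>
          set xs \<subseteq> univ (order_structure (univ X) r) \<longrightarrow>
          (xs \<in> interp (order_structure (univ X) r) i \<longleftrightarrow> map \<phi> xs \<in> interp (substructure real_line S) i)"
        using \<phi> unfolding isomorphism_def embedding_def by blast
      from this[rule_format, of "[x, y]" "()"] xy
      have "[x, y] \<in> interp (order_structure (univ X) r) () \<longleftrightarrow>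
          [\<phi> x, \<phi> y] \<in> interp (substructure real_line S) ()"
        by (simp add: order_structure_def)
      ultimately show ?thesis
        by (simp add: order_structure_def substructure_def real_line_def relation_of_def)
    qed
  qed
  have fatS: "fat S" using perfect_fat[OF assms(7)] assms(8) by (rule fat_mono)
  have pre: "preord (copies_poset X)" by (simp add: copies_poset_def preord_relation_of_subset)
  note sub = preord_relation_of_subset
  have "ba_isomorphic (copies_completion X) (ro (copies_poset X))"
    unfolding copies_completion_def using ba_isomorphic_ro_sq[OF pre] .
  moreover have "ba_isomorphic (ro (copies_poset X)) (ro (fat_poset S))"
    \<comment> \<open>A dense embedding yields an isomorphism from the completion of its target to
      that of its source; since copies embed into fat sets, this link has to be inverted.\<close>
    using ba_isomorphic_ro_sym[OF sub ba_isomorphic_dense_embedding[OF pre sub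
          dense_embedding_copies[OF assms(2) fatS]]] .
  moreover have "ba_isomorphic (ro (fat_poset S)) (ro (relation_of (\<subseteq>) {A. fat A}))"
    using ba_isomorphic_fat_poset[OF fatS] .
  moreover have "ba_isomorphic (ro (relation_of (\<subseteq>) {A. fat A})) (ro sacks)"
    using ba_isomorphic_dense_embedding[OF preord_sacks sub dense_embedding_sacks_fat] .
  ultimately show "ba_isomorphic (copies_completion X) (ro sacks)"
    by (meson ba_isomorphic_trans)
  show "ba_isomorphic (ro sacks) (ro (positive_poset borel_mod_countable))"
    using ba_isomorphic_ro_sym[OF preord_borel_poset
        ba_isomorphic_dense_embedding[OF preord_sacks preord_borel_poset dense_embedding_sacks_borel]] .
qed

end
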